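(* For each integer $r\ge1$ let $\Gamma(r)$ be the zero-sum repeated game with symmetric information described in the context, with value functions $v^r_n:\Delta(K)\to\mathbb{R}$ of its $n$-stage game ($n\in\mathbb{N}^*$) and $v^r_\lambda:\Delta(K)\to\mathbb{R}$ of its $\lambda$-discounted game ($\lambda\in(0,1]$). There exists $r_0\in\mathbb{N}^*$ such that for all $r\ge r_0$, $(v^r_n)$ does not converge (pointwise on $\Delta(K)$) when $n\to+\infty$ and $(v^r_\lambda)$ does not converge (pointwise on $\Delta(K)$) when $\lambda\to0$.
   Context: $\mathbb{N}^*=\{1,2,\dots\}$. Zero-sum repeated game with symmetric information: there are a finite state space $K$, finite action sets $I$ (Player 1) and $J$ (Player 2), a finite set $A$ of public signals, a transition $q:K\times I\times J\to\Delta(K\times A)$ and a payoff function $g:K\times I\times J\to\mathbb{R}$, all known to both players. Given $p\in\Delta(K)$ (probability measures on $K$), known to both players, an initial state $k_1$ is drawn from $p$ and is not announced. At each stage $m\ge1$ the players simultaneously and independently choose $i_m\in I$, $j_m\in J$; the stage payoff is $g_m=g(k_m,i_m,j_m)$; a pair $(k_{m+1},a_m)$ is drawn from $q(k_m,i_m,j_m)$; both players observe $(i_m,j_m)$ and $a_m$ (but not $k_{m+1}$), and the game moves to $k_{m+1}$. A behavior strategy maps each finite public history $(i_1,j_1,a_1,\dots,i_{m-1},j_{m-1},a_{m-1})$, $m\ge1$, to a probability distribution on the player's action set; $\Sigma$, $\mathcal{T}$ are the sets of behavior strategies of Players 1, 2. The $\lambda$-discounted game with initial distribution $p$ has payoff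 $\mathbb{E}^p_{\sigma,\tau}\big(\sum_{m\ge1}\lambda(1-\lambda)^{m-1}g_m\big)$ and the $n$-stage game has payoff $\mathbb{E}^p_{\sigma,\tau}\big(\frac1n\sum_{m=1}^n g_m\big)$, maximized by Player 1 and minimized by Player 2; their values ($\max_\sigma\min_\tau=\min_\tau\max_\sigma$) are denoted $v_\lambda(p)$ and $v_n(p)$ (here $v^r_\lambda(p)$ and $v^r_n(p)$ for $\Gamma(r)$). The game $\Gamma(r)$, $r\ge1$: $K=\{1^{++},1^{T_1},\dots,1^{T_{2r-1}},1^+,1^*,0^{++},0^{T_1},\dots,0^{T_{r-1}},0^+,0^*\}$, $I=J=\{C,Q\}$, $A=\{D,D'\}$; convention $1^{T_0}:=1^{++}$ and $0^{T_0}:=0^{++}$. Payoffs are independent of actions: $1$ in states $1^*,1^{++},1^{T_1},\dots,1^{T_{2r-1}},1^+$ and $0$ in the other states. States $1^*$ and $0^*$ are absorbing (signal irrelevant, say always $D$). In states $1^{T_0},\dots,1^{T_{2r-1}},1^+$ the transition depends only on Player 2's action; in states $0^{T_0},\dots,0^{T_{r-1}},0^+$ only on Player 1's action. According to the action of the controlling player, the transitions (next state, public signal) are: - state $0^{T_l}$, $0\le l\le r-2$: under $C$, $(0^{T_{l+1}},D)$ with probability $1/2$ and $(0^{++},D')$ with probability $1/2$; - state $0^{T_{r-1}}$: under $C$, $(0^{++},D)$ with probability $2^{-r}/2$, $(0^+,D)$ with probability $(1-2^{-r})/2$, $(0^{++},D')$ with probability $1/2$; - state $0^+$: under $C$, $(0^+,D)$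 with probability $1/2$ and $(0^{++},D')$ with probability $1/2$; - under $Q$: from each $0^{T_l}$, $0\le l\le r-1$, $(0^*,D')$ with probability $1$; from $0^+$, $(1^{++},D)$ with probability $1$; - state $1^{T_l}$, $0\le l\le 2r-2$: under $C$, $(1^{T_{l+1}},D)$ with probability $1/2$ and $(1^{++},D')$ with probability $1/2$; - state $1^{T_{2r-1}}$: under $C$, $(1^{++},D)$ with probability $2^{-2r}/2$, $(1^+,D)$ with probability $(1-2^{-2r})/2$, $(1^{++},D')$ with probability $1/2$; - state $1^+$: under $C$, $(1^+,D)$ with probability $1/2$ and $(1^{++},D')$ with probability $1/2$; - under $Q$: from each $1^{T_l}$, $0\le l\le 2r-1$, $(1^*,D')$ with probability $1$; from $1^+$, $(0^{++},D)$ with probability $1$. *)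

theory Defs
  imports "HOL-Probability.Probability"
begin

section \<open>Zero-sum repeated games with symmetric information\<close>

text \<open>
  The action sets and the signal set are finite types, whereas the state space is a carrier set,
  since it varies with the parameter of the family of games below.  The transition and the
  payoff are irrelevant outside the carrier.
\<close>

record ('k, 'i, 'j, 'a) game =
  state_space :: "'k set"
  transition :: "'k \<Rightarrow> 'i \<Rightarrow> 'j \<Rightarrow> ('k \<times> 'a) pmf"
  payoff :: "'k \<Rightarrow> 'i \<Rightarrow> 'j \<Rightarrow> real"

definition wf_game :: "('k, 'i, 'j, 'a) game \<Rightarrow> bool" where
  "wf_game G \<longleftrightarrow> finite (state_space G) \<and> state_space G \<noteq> {} \<and>
     (\<forall>k\<in>state_space G. \<forall>i j. set_pmf (transition G k i j) \<subseteq> state_space G \<times> UNIV)"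

definition prob_on :: "'k set \<Rightarrow> 'k pmf set" where
  "prob_on K = {p. set_pmf p \<subseteq> K}"

type_synonym ('i, 'j, 'a) history = "('i \<times> 'j \<times> 'a) list"
type_synonym ('i, 'j, 'a) strategy1 = "('i, 'j, 'a) history \<Rightarrow> 'i pmf"
type_synonym ('i, 'j, 'a) strategy2 = "('i, 'j, 'a) history \<Rightarrow> 'j pmf"

text \<open>
  A stage is recorded as \<open>(k, i, j, k', a)\<close>: current state, actions, next state, signal.
  The next state is stored because it is drawn jointly with the signal.
  A play is a function \<open>\<omega>\<close> on the naturals; \<open>\<omega> m\<close> is stage number \<open>m + 1\<close>.
\<close>

type_synonym ('k, 'i, 'j, 'a) stage = "'k \<times> 'i \<times> 'j \<times> 'k \<times> 'a"

definition next_state :: "('k, 'i, 'j, 'a) stage \<Rightarrow> 'k" where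
  "next_state = (\<lambda>(k, i, j, k', a). k')"

definition public_part :: "('k, 'i, 'j, 'a) stage \<Rightarrow> 'i \<times> 'j \<times> 'a" where
  "public_part = (\<lambda>(k, i, j, k', a). (i, j, a))"

definition stage_payoff :: "('k, 'i, 'j, 'a) game \<Rightarrow> ('k, 'i, 'j, 'a) stage \<Rightarrow> real" where
  "stage_payoff G = (\<lambda>(k, i, j, k', a). payoff G k i j)"

definition public_history ::
    "nat \<Rightarrow> (nat \<Rightarrow> ('k, 'i, 'j, 'a) stage) \<Rightarrow> ('i, 'j, 'a) history" where
  "public_history m \<omega> = map (\<lambda>n. public_part (\<omega> n)) [0..<m]"

definition stage_law ::
    "('k, 'i, 'j, 'a) game \<Rightarrow> ('i, 'j, 'a) strategy1 \<Rightarrow> ('i, 'j, 'a) strategy2 \<Rightarrow>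
     ('i, 'j, 'a) history \<Rightarrow> 'k \<Rightarrow> ('k, 'i, 'j, 'a) stage pmf" where
  "stage_law G \<sigma> \<tau> h k =
     bind_pmf (\<sigma> h) (\<lambda>i. bind_pmf (\<tau> h) (\<lambda>j.
       map_pmf (\<lambda>(k', a). (k, i, j, k', a)) (transition G k i j)))"

text \<open>Conditional law of \<open>\<omega> m\<close> given \<open>\<omega> 0, \<dots>, \<omega> (m - 1)\<close>.\<close>

definition play_kernel ::
    "('k, 'i, 'j, 'a) game \<Rightarrow> 'k pmf \<Rightarrow> ('i, 'j, 'a) strategy1 \<Rightarrow> ('i, 'j, 'a) strategy2 \<Rightarrow>
     nat \<Rightarrow> (nat \<Rightarrow> ('k, 'i, 'j, 'a) stage) \<Rightarrow> ('k, 'i, 'j, 'a) stage pmf" where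
  "play_kernel G p \<sigma> \<tau> m \<omega> =
     bind_pmf (if m = 0 then p else return_pmf (next_state (\<omega> (m - 1))))
       (stage_law G \<sigma> \<tau> (public_history m \<omega>))"

text \<open>
  The Ionescu-Tulcea measure on infinite plays; the lemma below shows that its hypotheses hold.
\<close>

definition play_measure ::
    "('k, 'i, 'j, 'a) game \<Rightarrow> 'k pmf \<Rightarrow> ('i, 'j, 'a) strategy1 \<Rightarrow> ('i, 'j, 'a) strategy2 \<Rightarrow>
     (nat \<Rightarrow> ('k, 'i, 'j, 'a) stage) measure" where
  "play_measure G p \<sigma> \<tau> =
     projective_family.lim UNIV
       (Ionescu_Tulcea.CI (\<lambda>m \<omega>. measure_pmf (play_kernel G p \<sigma> \<tau> m \<omega>)) (\<lambda>_. count_space UNIV))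
       (\<lambda>_. count_space UNIV)"

lemma play_kernel_restrict:
  "play_kernel G p \<sigma> \<tau> m (restrict \<omega> {0..<m}) = play_kernel G p \<sigma> \<tau> m \<omega>"
proof -
  have "public_history m (restrict \<omega> {0..<m}) = public_history m \<omega>"
    by (simp add: public_history_def)
  then show ?thesis
    by (simp add: play_kernel_def)
qed

lemma Ionescu_Tulcea_play_kernel:
  fixes G :: "('k::countable, 'i::finite, 'j::finite, 'a::finite) game"
  shows "Ionescu_Tulcea (\<lambda>m \<omega>. measure_pmf (play_kernel G p \<sigma> \<tau> m \<omega>)) (\<lambda>_. count_space UNIV)"
proof (rule Ionescu_Tulcea.intro)
  let ?S = "count_space (UNIV :: ('k, 'i, 'j, 'a) stage set)"
  show "(\<lambda>\<omega>. measure_pmf (play_kernel G p \<sigma> \<tau> m \<omega>))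
      \<in> measurable (PiM {0..<m} (\<lambda>_. ?S)) (subprob_algebra ?S)" for m
  proof -
    have "PiM {0..<m} (\<lambda>_. ?S) = count_space (PiE {0..<m} (\<lambda>_. UNIV))"
      by (rule count_space_PiM_finite) auto
    then show ?thesis
      by (auto simp: space_subprob_algebra
          intro!: prob_space_imp_subprob_space prob_space_measure_pmf)
  qed
qed (rule prob_space_measure_pmf)

definition payoff_n ::
    "('k, 'i, 'j, 'a) game \<Rightarrow> nat \<Rightarrow> 'k pmf \<Rightarrow>
     ('i, 'j, 'a) strategy1 \<Rightarrow> ('i, 'j, 'a) strategy2 \<Rightarrow> real" where
  "payoff_n G n p \<sigma> \<tau> =
     (\<integral>\<omega>. 1 / real n * (\<Sum>m<n. stage_payoff G (\<omega> m)) \<partial>play_measure G p \<sigma> \<tau>)"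

definition payoff_disc ::
    "('k, 'i, 'j, 'a) game \<Rightarrow> real \<Rightarrow> 'k pmf \<Rightarrow>
     ('i, 'j, 'a) strategy1 \<Rightarrow> ('i, 'j, 'a) strategy2 \<Rightarrow> real" where
  "payoff_disc G l p \<sigma> \<tau> =
     (\<integral>\<omega>. (\<Sum>m. l * (1 - l) ^ m * stage_payoff G (\<omega> m)) \<partial>play_measure G p \<sigma> \<tau>)"

text \<open>
  The first player can guarantee \<open>v\<close> and so can the second, i.e. \<open>v\<close> is both the max-min and
  the min-max, attained at optimal strategies.  At most one \<open>v\<close> qualifies, and for the payoffs
  above (with \<open>n \<ge> 1\<close>, \<open>0 < l \<le> 1\<close>, \<open>wf_game G\<close>, \<open>p \<in> prob_on (state_space G)\<close>) one does.
\<close>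

definition has_value :: "('s \<Rightarrow> 't \<Rightarrow> real) \<Rightarrow> real \<Rightarrow> bool" where
  "has_value \<gamma> v \<longleftrightarrow> (\<exists>\<sigma>. \<forall>\<tau>. v \<le> \<gamma> \<sigma> \<tau>) \<and> (\<exists>\<tau>. \<forall>\<sigma>. \<gamma> \<sigma> \<tau> \<le> v)"

lemma has_value_unique: "has_value \<gamma> v \<Longrightarrow> has_value \<gamma> w \<Longrightarrow> v = w"
  unfolding has_value_def by (meson antisym order_trans)

definition value_n :: "('k, 'i, 'j, 'a) game \<Rightarrow> nat \<Rightarrow> 'k pmf \<Rightarrow> real" where
  "value_n G n p = (THE v. has_value (payoff_n G n p) v)"

definition value_disc :: "('k, 'i, 'j, 'a) game \<Rightarrow> real \<Rightarrow> 'k pmf \<Rightarrow> real" where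
  "value_disc G l p = (THE v. has_value (payoff_disc G l p) v)"


section \<open>The games \<open>\<Gamma>(r)\<close>\<close>

text \<open>
  \<open>One_T l\<close> is $1^{T_l}$, so that \<open>One_T 0\<close> is $1^{++}$; \<open>One_plus\<close> is $1^+$ and \<open>One_star\<close> is $1^*$.
  Likewise for the states of type \<open>0\<close>.
\<close>

datatype state =
  One_T nat | One_plus | One_star | Zero_T nat | Zero_plus | Zero_star

instance state :: countable
  by countable_datatype

datatype action = C | Q

instance action :: finite
proof
  have "(UNIV :: action set) = {C, Q}"
    using action.exhaust by auto
  then show "finite (UNIV :: action set)"
    by (metis finite.emptyI finite.insertI)
qed

datatype signal = D | D'

instance signal :: finite
proof
  have "(UNIV :: signal set) = {D, D'}"
    using signal.exhaust by auto
  then show "finite (UNIV :: signal set)"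
    by (metis finite.emptyI finite.insertI)
qed

definition Gamma_states :: "nat \<Rightarrow> state set" where
  "Gamma_states r =
     One_T ` {..<2 * r} \<union> {One_plus, One_star} \<union> Zero_T ` {..<r} \<union> {Zero_plus, Zero_star}"

fun Gamma_transition :: "nat \<Rightarrow> state \<Rightarrow> action \<Rightarrow> action \<Rightarrow> (state \<times> signal) pmf" where
  "Gamma_transition r (Zero_T l) C j =
     (if l + 1 < r
      then pmf_of_list [((Zero_T (l + 1), D), 1/2), ((Zero_T 0, D'), 1/2)]
      else pmf_of_list [((Zero_T 0, D), (1/2) ^ r / 2), ((Zero_plus, D), (1 - (1/2) ^ r) / 2),
                        ((Zero_T 0, D'), 1/2)])"
| "Gamma_transition r Zero_plus C j =
     pmf_of_list [((Zero_plus, D), 1/2), ((Zero_T 0, D'), 1/2)]"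
| "Gamma_transition r (Zero_T l) Q j = return_pmf (Zero_star, D')"
| "Gamma_transition r Zero_plus Q j = return_pmf (One_T 0, D)"
| "Gamma_transition r Zero_star i j = return_pmf (Zero_star, D)"
| "Gamma_transition r (One_T l) i C =
     (if l + 1 < 2 * r
      then pmf_of_list [((One_T (l + 1), D), 1/2), ((One_T 0, D'), 1/2)]
      else pmf_of_list [((One_T 0, D), (1/2) ^ (2 * r) / 2),
                        ((One_plus, D), (1 - (1/2) ^ (2 * r)) / 2), ((One_T 0, D'), 1/2)])"
| "Gamma_transition r One_plus i C =
     pmf_of_list [((One_plus, D), 1/2), ((One_T 0, D'), 1/2)]"
| "Gamma_transition r (One_T l) i Q = return_pmf (One_star, D')"
| "Gamma_transition r One_plus i Q = return_pmf (Zero_T 0, D)"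
| "Gamma_transition r One_star i j = return_pmf (One_star, D)"

fun Gamma_payoff :: "state \<Rightarrow> action \<Rightarrow> action \<Rightarrow> real" where
  "Gamma_payoff (One_T l) i j = 1"
| "Gamma_payoff One_plus i j = 1"
| "Gamma_payoff One_star i j = 1"
| "Gamma_payoff (Zero_T l) i j = 0"
| "Gamma_payoff Zero_plus i j = 0"
| "Gamma_payoff Zero_star i j = 0"

definition Gamma_game :: "nat \<Rightarrow> (state, action, action, signal) game" where
  "Gamma_game r =
     \<lparr>state_space = Gamma_states r, transition = Gamma_transition r, payoff = Gamma_payoff\<rparr>"

text \<open>The lists of weights above are genuine probability distributions.\<close>

lemma Gamma_weights_wf:
  "pmf_of_list_wf [(x, 1/2), (y, 1/2 :: real)]"
  "pmf_of_list_wf [(x, (1/2) ^ s / 2), (y, (1 - (1/2) ^ s) / 2), (z, 1/2 :: real)]"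
  by (auto simp: pmf_of_list_wf_def power_le_one field_simps)

lemma wf_Gamma_game:
  assumes "r \<ge> 1"
  shows "wf_game (Gamma_game r)"
proof -
  have "set_pmf (Gamma_transition r k i j) \<subseteq> Gamma_states r \<times> UNIV"
    if "k \<in> Gamma_states r" for k i j
    using that assms
    by (cases "(r, k, i, j)" rule: Gamma_transition.cases)
       (auto simp: Gamma_states_def dest!: subsetD[OF set_pmf_of_list[OF Gamma_weights_wf(1)]]
          subsetD[OF set_pmf_of_list[OF Gamma_weights_wf(2)]] split: if_splits)
  then show ?thesis
    by (auto simp: wf_game_def Gamma_game_def) (auto simp: Gamma_states_def)
qed

end

theory Submission
  imports Defs
begin

text \<open>
  The state is hidden, but what the players know about it has a simple form.  Say that the play is
  on side \<open>b\<close> when the payoff is \<open>1\<close> (\<open>b = True\<close>, Player 2 controls) or \<open>0\<close> (\<open>b = False\<close>, Player 1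
  controls).  Whoever controls the side wants to leave it.  The signal \<open>D'\<close> under \<open>C\<close> sends the play
  back to the first state of the side, and after \<open>n\<close> consecutive signals \<open>D\<close> the state is \<open>+\<close> except
  with probability \<open>2 ^ (- R b * \<lfloor>n / R b\<rfloor>)\<close>, where the period \<open>R b\<close> is \<open>r\<close> for Player 1 and \<open>2 r\<close> for
  Player 2.  Quitting at that moment leads to the other side, or, with this probability, to
  absorption on the same side.  Hence the belief is a pair \<open>(b, n)\<close>, and the game is a game of
  perfect information on these beliefs: its values solve dynamic programming equations, and playing
  an optimal action of these equations is an optimal strategy (\<open>verification\<close>).

  Let \<open>x\<close> and \<open>y\<close> be the discounted values at the first states of the sides \<open>1\<close> and \<open>0\<close>.  Waiting for
  \<open>n\<close> signals \<open>D\<close> takes about \<open>2 ^ n\<close> stages, so for Player 1 the relative loss \<open>(x - y) / y\<close> is, up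
  to constants, the minimum over \<open>n\<close> of \<open>l * 2 ^ n\<close> plus the risk, and \<open>(x - y) / (1 - x)\<close> is the
  same quantity for Player 2 (\<open>solution_gap_ge\<close>, \<open>solution_gap_le\<close>).  When \<open>l = 2 ^ (- 2 n)\<close> and
  \<open>n\<close> is a multiple of the period, the minimum is of order \<open>2 ^ (- n) = sqrt l\<close>.  If \<open>n\<close> is a multiple of
  \<open>2 r\<close>, both players achieve this order and \<open>y\<close> stays away from \<open>1\<close> (\<open>discounted_value_low\<close>).  If \<open>n\<close>
  is an odd multiple of \<open>r\<close>, then \<open>n\<close> lies in the middle of a period of Player 2, whose loss is larger
  by a factor of order \<open>2 ^ r\<close>, and \<open>y\<close> is close to \<open>1\<close> (\<open>discounted_value_high\<close>).  So the
  discounted values oscillate.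

  For the \<open>n\<close>-stage values the argument is Tauberian: if they converged, the convergence would be
  uniform over beliefs, because both kinds of beliefs are squeezed between the first states of the two
  sides (\<open>total_sandwich\<close>), with the same limit at both (\<open>total_value_limits_agree\<close>).  Comparing the
  discounted game with \<open>l = 1 / L\<close> to the \<open>L\<close>-stage game over an initial block of \<open>L / M\<close> stages then
  forces the discounted values to converge to the same limit (\<open>tauberian_block\<close>), a contradiction.
\<close>

section \<open>The law of the stages of a play\<close>

text \<open>Expected stage payoffs only involve the joint law of the public history and the
  current state, which lives on a countable space.\<close>

primrec prefix_law ::
    "('k, 'i, 'j, 'a) game \<Rightarrow> 'k pmf \<Rightarrow> ('i, 'j, 'a) strategy1 \<Rightarrow> ('i, 'j, 'a) strategy2 \<Rightarrow>
     nat \<Rightarrow> (('i, 'j, 'a) history \<times> 'k) pmf" where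
  "prefix_law G p \<sigma> \<tau> 0 = map_pmf (Pair []) p"
| "prefix_law G p \<sigma> \<tau> (Suc m) =
     bind_pmf (prefix_law G p \<sigma> \<tau> m) (\<lambda>(h, k).
       map_pmf (\<lambda>s. (h @ [public_part s], next_state s)) (stage_law G \<sigma> \<tau> h k))"

lemma public_history_Suc:
  "public_history (Suc m) (fun_upd \<omega> m s) = public_history m \<omega> @ [public_part s]"
  by (auto simp: public_history_def)

text \<open>The marginals of the Ionescu-Tulcea measure on the first \<open>m\<close> stages are obtained by
  composing the kernels, so the law of stage \<open>m\<close> follows by induction on \<open>m\<close>.  Stating this for
  functions with values in \<^typ>\<open>ennreal\<close> removes all integrability conditions.\<close>

lemma nn_integral_play_measure_stage:
  fixes G :: "('k::countable, 'i::finite, 'j::finite, 'a::finite) game"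
    and f :: "('k, 'i, 'j, 'a) stage \<Rightarrow> ennreal"
  shows "(\<integral>\<^sup>+\<omega>. f (\<omega> m) \<partial>play_measure G p \<sigma> \<tau>) =
    (\<integral>\<^sup>+(h, k). (\<integral>\<^sup>+s. f s \<partial>stage_law G \<sigma> \<tau> h k) \<partial>prefix_law G p \<sigma> \<tau> m)"
proof -
  let ?M = "\<lambda>_::nat. count_space (UNIV :: ('k, 'i, 'j, 'a) stage set)"
  let ?P = "\<lambda>m \<omega>. measure_pmf (play_kernel G p \<sigma> \<tau> m \<omega>)"
  interpret IT: Ionescu_Tulcea ?P ?M
    by (rule Ionescu_Tulcea_play_kernel)
  define c where "c n = IT.C 0 n (\<lambda>_. undefined)" for n
  have PiM_eq: "PiM {0..<n} ?M = count_space (PiE {0..<n} (\<lambda>_. UNIV))" for n :: nat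
    by (rule count_space_PiM_finite) auto
  have meas: "g \<in> borel_measurable (PiM {0..<n} ?M)" for n and g :: "_ \<Rightarrow> ennreal"
    unfolding PiM_eq by simp
  have undef: "(\<lambda>_. undefined) \<in> space (PiM {0..<0} ?M)"
    by simp
  have sets_c: "sets (c n) = sets (PiM {0..<n} ?M)" for n
    unfolding c_def using IT.sets_C[OF undef, of n] by simp
  have space_c: "space (c n) = space (PiM {0..<n} ?M)" for n
    by (rule sets_eq_imp_space_eq[OF sets_c])
  have c_Suc: "(\<integral>\<^sup>+\<omega>. g \<omega> \<partial>c (Suc n)) = (\<integral>\<^sup>+\<omega>. (\<integral>\<^sup>+s. g (fun_upd \<omega> n s) \<partial>?P n \<omega>) \<partial>c n)"
    for n and g :: "_ \<Rightarrow> ennreal"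
  proof -
    have "(\<integral>\<^sup>+\<omega>. g \<omega> \<partial>c (Suc n)) = (\<integral>\<^sup>+\<omega>. (\<integral>\<^sup>+x. g x \<partial>IT.eP n \<omega>) \<partial>c n)"
      unfolding c_def using meas[of g "Suc n"] IT.measurable_eP[of n]
      by (simp, subst nn_integral_bind[where B = "PiM {0..<Suc n} ?M"])
         (auto simp: measurable_cong_sets[OF sets_c[unfolded c_def] refl])
    also have "\<dots> = (\<integral>\<^sup>+\<omega>. (\<integral>\<^sup>+s. g (fun_upd \<omega> n s) \<partial>?P n \<omega>) \<partial>c n)"
      by (intro nn_integral_cong IT.nn_integral_eP meas) (simp add: space_c)
    finally show ?thesis .
  qed
  \<comment> \<open>The initial state is not recorded before the first stage: it is still random at stage \<open>0\<close>,
    whereas later the current state is a function of the play.\<close>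
  define cur where
    "cur n \<omega> = (if n = 0 then p else return_pmf (next_state (\<omega> (n - 1))))"
    for n :: nat and \<omega> :: "nat \<Rightarrow> ('k, 'i, 'j, 'a) stage"
  have kernel: "play_kernel G p \<sigma> \<tau> n \<omega> =
      bind_pmf (cur n \<omega>) (stage_law G \<sigma> \<tau> (public_history n \<omega>))" for n \<omega>
    by (simp add: play_kernel_def cur_def)
  have prefix: "(\<integral>\<^sup>+\<omega>. (\<integral>\<^sup>+k. g (public_history n \<omega>) k \<partial>cur n \<omega>) \<partial>c n) =
      (\<integral>\<^sup>+(h, k). g h k \<partial>prefix_law G p \<sigma> \<tau> n)"
    for n and g :: "_ \<Rightarrow> _ \<Rightarrow> ennreal"
  proof (induction n arbitrary: g)
    case 0
    show ?case
      unfolding c_def by (subst IT.C.simps, subst nn_integral_return)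
        (auto simp: cur_def public_history_def meas[where n = 0, simplified] case_prod_unfold)
  next
    case (Suc n)
    let ?g = "\<lambda>h k. \<integral>\<^sup>+s. g (h @ [public_part s]) (next_state s) \<partial>stage_law G \<sigma> \<tau> h k"
    have "(\<integral>\<^sup>+\<omega>. (\<integral>\<^sup>+k. g (public_history (Suc n) \<omega>) k \<partial>cur (Suc n) \<omega>) \<partial>c (Suc n)) =
      (\<integral>\<^sup>+\<omega>. (\<integral>\<^sup>+k. ?g (public_history n \<omega>) k \<partial>cur n \<omega>) \<partial>c n)"
      unfolding c_Suc kernel
      by (simp add: cur_def[of "Suc n"] public_history_Suc nn_integral_bind_pmf nn_integral_return)
    also have "\<dots> = (\<integral>\<^sup>+(h, k). ?g h k \<partial>prefix_law G p \<sigma> \<tau> n)"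
      by (rule Suc)
    finally show ?case
      by (simp add: nn_integral_bind_pmf case_prod_unfold nn_integral_map_pmf)
  qed
  have lim_eq: "distr IT.PF.lim (PiM {0..<n} ?M) (\<lambda>\<omega>. restrict \<omega> {0..<n}) = c n" for n
  proof (rule measure_eqI)
    fix X assume "X \<in> sets (distr IT.PF.lim (PiM {0..<n} ?M) (\<lambda>\<omega>. restrict \<omega> {0..<n}))"
    then have X: "X \<in> sets (PiM {0..<n} ?M)"
      by simp
    have "emeasure (distr IT.PF.lim (PiM {0..<n} ?M) (\<lambda>\<omega>. restrict \<omega> {0..<n})) X =
        emeasure IT.PF.lim (prod_emb UNIV ?M {0..<n} X)"
      using X by (intro emeasure_distr_restrict) auto
    also have "\<dots> = emeasure (c n) X"
      using X sets.sets_into_space[OF X]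
      by (subst IT.lim) (auto simp: IT.emeasure_CI[of _ n] c_def prod_emb_id space_PiM)
    finally show "emeasure (distr IT.PF.lim (PiM {0..<n} ?M) (\<lambda>\<omega>. restrict \<omega> {0..<n})) X =
        emeasure (c n) X" .
  qed (simp add: sets_c)
  have "(\<integral>\<^sup>+\<omega>. f (\<omega> m) \<partial>play_measure G p \<sigma> \<tau>) =
      (\<integral>\<^sup>+\<omega>. f (restrict \<omega> {0..<Suc m} m) \<partial>IT.PF.lim)"
    by (simp add: play_measure_def)
  also have "\<dots> = (\<integral>\<^sup>+\<omega>. f (\<omega> m) \<partial>c (Suc m))"
    unfolding lim_eq[symmetric]
    by (subst nn_integral_distr)
       (auto intro!: meas measurable_restrict simp: measurable_cong_sets[OF IT.PF.sets_lim refl])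
  also have "\<dots> = (\<integral>\<^sup>+\<omega>. (\<integral>\<^sup>+k. (\<integral>\<^sup>+s. f s \<partial>stage_law G \<sigma> \<tau> (public_history m \<omega>) k) \<partial>cur m \<omega>) \<partial>c m)"
    unfolding c_Suc kernel by (simp add: nn_integral_bind_pmf)
  also have "\<dots> = (\<integral>\<^sup>+(h, k). (\<integral>\<^sup>+s. f s \<partial>stage_law G \<sigma> \<tau> h k) \<partial>prefix_law G p \<sigma> \<tau> m)"
    by (rule prefix)
  finally show ?thesis .
qed

lemma sets_play_measure:
  fixes G :: "('k::countable, 'i::finite, 'j::finite, 'a::finite) game"
  shows "sets (play_measure G p \<sigma> \<tau>) = sets (PiM UNIV (\<lambda>_. count_space UNIV))"
proof -
  interpret IT: Ionescu_Tulcea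
      "\<lambda>m \<omega>. measure_pmf (play_kernel G p \<sigma> \<tau> m \<omega>)" "\<lambda>_. count_space UNIV"
    by (rule Ionescu_Tulcea_play_kernel)
  show ?thesis
    unfolding play_measure_def by (rule IT.PF.sets_lim)
qed

lemma expectation_state_payoff:
  fixes G :: "('k::countable, 'i::finite, 'j::finite, 'a::finite) game"
  assumes u: "\<And>k i j. payoff G k i j = u k" "\<And>k. 0 \<le> u k" "\<And>k. u k \<le> 1"
  shows "(\<integral>\<omega>. stage_payoff G (\<omega> m) \<partial>play_measure G p \<sigma> \<tau>) =
      measure_pmf.expectation (prefix_law G p \<sigma> \<tau> m) (\<lambda>(h, k). u k)" (is "?A = ?B")
    and "integrable (play_measure G p \<sigma> \<tau>) (\<lambda>\<omega>. stage_payoff G (\<omega> m))"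
proof -
  let ?N = "play_measure G p \<sigma> \<tau>"
  let ?L = "prefix_law G p \<sigma> \<tau> m"
  have sp: "stage_payoff G s = u (fst s)" for s
    by (auto simp: stage_payoff_def u split: prod.splits)
  have fst_law: "AE s in stage_law G \<sigma> \<tau> h k. fst s = k" for h k
    by (auto simp: AE_measure_pmf_iff stage_law_def)
  have meas: "(\<lambda>\<omega>. stage_payoff G (\<omega> m)) \<in> borel_measurable ?N"
    unfolding measurable_cong_sets[OF sets_play_measure refl] by measurable
  have nn: "(\<integral>\<^sup>+\<omega>. stage_payoff G (\<omega> m) \<partial>?N) = (\<integral>\<^sup>+(h, k). u k \<partial>?L)"
  proof -
    have "(\<integral>\<^sup>+s. stage_payoff G s \<partial>stage_law G \<sigma> \<tau> h k) = ennreal (u k)" for h k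
    proof -
      have "(\<integral>\<^sup>+s. stage_payoff G s \<partial>stage_law G \<sigma> \<tau> h k) =
          (\<integral>\<^sup>+s. u k \<partial>stage_law G \<sigma> \<tau> h k)"
        using fst_law[where h = h and k = k] by (intro nn_integral_cong_AE) (auto simp: sp)
      then show ?thesis
        by simp
    qed
    then show ?thesis
      using nn_integral_play_measure_stage[where f = "\<lambda>s. ennreal (stage_payoff G s)"] by (simp add: case_prod_unfold)
  qed
  also have L: "\<dots> = ennreal ?B"
    by (subst nn_integral_eq_integral[symmetric])
       (auto intro!: measure_pmf.integrable_const_bound[where B = 1] nn_integral_cong simp: u
         split: prod.splits)
  finally have nn': "(\<integral>\<^sup>+\<omega>. stage_payoff G (\<omega> m) \<partial>?N) = ennreal ?B" .
  show "integrable ?N (\<lambda>\<omega>. stage_payoff G (\<omega> m))"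
    using meas by (rule integrableI_nonneg) (simp_all add: nn', simp add: sp u)
  have "0 \<le> ?B"
    by (intro Bochner_Integration.integral_nonneg) (auto simp: u)
  moreover have "?A = enn2real (\<integral>\<^sup>+\<omega>. stage_payoff G (\<omega> m) \<partial>?N)"
    using meas by (intro integral_eq_nn_integral) (auto simp: sp u)
  ultimately show "?A = ?B"
    unfolding nn' by simp
qed

lemma payoff_n_state_payoff:
  fixes G :: "('k::countable, 'i::finite, 'j::finite, 'a::finite) game"
  assumes u: "\<And>k i j. payoff G k i j = u k" "\<And>k. 0 \<le> u k" "\<And>k. u k \<le> 1"
  shows "payoff_n G n p \<sigma> \<tau> = (\<Sum>m<n. 1 / real n *
      measure_pmf.expectation (prefix_law G p \<sigma> \<tau> m) (\<lambda>(h, k). u k))"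
  unfolding payoff_n_def
  by (subst integral_mult_right_zero, subst Bochner_Integration.integral_sum)
     (simp_all add: expectation_state_payoff[where u = u] u sum_distrib_left)

lemma payoff_disc_state_payoff:
  fixes G :: "('k::countable, 'i::finite, 'j::finite, 'a::finite) game"
  assumes u: "\<And>k i j. payoff G k i j = u k" "\<And>k. 0 \<le> u k" "\<And>k. u k \<le> 1"
    and l: "0 < l" "l \<le> 1"
  shows "(\<lambda>m. l * (1 - l) ^ m *
      measure_pmf.expectation (prefix_law G p \<sigma> \<tau> m) (\<lambda>(h, k). u k))
    sums payoff_disc G l p \<sigma> \<tau>"
proof -
  let ?N = "play_measure G p \<sigma> \<tau>"
  let ?f = "\<lambda>m \<omega>. l * (1 - l) ^ m * stage_payoff G (\<omega> m)"
  have sp: "stage_payoff G s = u (fst s)" for s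
    by (auto simp: stage_payoff_def u split: prod.splits)
  have bound: "\<bar>stage_payoff G s\<bar> \<le> 1" "0 \<le> stage_payoff G s" for s
    by (auto simp: sp u)
  have int: "integrable ?N (?f m)" for m
    by (intro integrable_mult_right expectation_state_payoff(2)[where u = u] u)
  have E: "(\<integral>\<omega>. ?f m \<omega> \<partial>?N) = l * (1 - l) ^ m *
      measure_pmf.expectation (prefix_law G p \<sigma> \<tau> m) (\<lambda>(h, k). u k)" for m
    by (simp add: expectation_state_payoff[where u = u] u)
  have geo: "summable (\<lambda>m. l * (1 - l) ^ m)"
    using l by (intro summable_mult summable_geometric) auto
  have "summable (\<lambda>m. norm (?f m \<omega>))" for \<omega>
    by (rule summable_comparison_test'[OF geo, of 0])
       (use l bound(1)[of "\<omega> _"] in \<open>auto simp: abs_mult simp del: split_paired_All intro!: mult_left_le\<close>)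
  moreover have "summable (\<lambda>m. \<integral>\<omega>. norm (?f m \<omega>) \<partial>?N)"
  proof (rule summable_comparison_test'[OF geo, of 0])
    fix m
    let ?L = "prefix_law G p \<sigma> \<tau> m"
    have "norm (?f m \<omega>) = ?f m \<omega>" for \<omega>
      using l bound(2)[of "\<omega> m"] by (simp add: abs_mult)
    then have "(\<integral>\<omega>. norm (?f m \<omega>) \<partial>?N) =
        l * (1 - l) ^ m * measure_pmf.expectation ?L (\<lambda>(h, k). u k)"
      using E[of m] by simp
    moreover have "\<bar>measure_pmf.expectation ?L (\<lambda>(h, k). u k)\<bar> \<le> 1"
    proof -
      have "0 \<le> measure_pmf.expectation ?L (\<lambda>(h, k). u k)"
        by (intro Bochner_Integration.integral_nonneg) (auto simp: u)
      moreover have "measure_pmf.expectation ?L (\<lambda>(h, k). u k) \<le> 1"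
        by (intro measure_pmf.integral_le_const measure_pmf.integrable_const_bound[where B = 1])
           (auto simp: u)
      ultimately show ?thesis
        by simp
    qed
    moreover have "0 \<le> l * (1 - l) ^ m"
      using l by simp
    ultimately show "norm (\<integral>\<omega>. norm (?f m \<omega>) \<partial>?N) \<le> l * (1 - l) ^ m"
      by (metis abs_mult abs_of_nonneg mult_left_le real_norm_def)
  qed
  ultimately have "(\<lambda>m. \<integral>\<omega>. ?f m \<omega> \<partial>?N) sums (\<integral>\<omega>. (\<Sum>m. ?f m \<omega>) \<partial>?N)"
    by (intro sums_integral int) auto
  then show ?thesis
    unfolding E payoff_disc_def .
qed

section \<open>Public beliefs\<close>

text \<open>\<open>Run b n\<close> is the belief on side \<open>b\<close> after \<open>n\<close> consecutive signals \<open>D\<close> under \<open>C\<close>, counted from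
  the last time at which the state was known to be the first state of the side; \<open>Done b\<close> is
  absorption.\<close>

datatype belief = Run bool nat | Done bool

fun side :: "belief \<Rightarrow> bool" where
  "side (Run b n) = b"
| "side (Done b) = b"

text \<open>The probability that the state is not \<open>+\<close> under the belief \<open>Run b n\<close>: each completed run of
  \<open>R b\<close> signals \<open>D\<close> multiplies it by \<open>2 ^ (- R b)\<close>.  The period \<open>R\<close> is arbitrary here, so that the two
  players can be exchanged.\<close>

definition risk :: "(bool \<Rightarrow> nat) \<Rightarrow> bool \<Rightarrow> nat \<Rightarrow> real" where
  "risk R b n = (1 / 2) ^ (R b * (n div R b))"

lemma risk_bounds: "0 < risk R b n" "risk R b n \<le> 1"
  by (auto simp: risk_def power_le_one)

fun continuation :: "(bool \<Rightarrow> nat) \<Rightarrow> (belief \<Rightarrow> real) \<Rightarrow> belief \<Rightarrow> action \<Rightarrow> real" where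
  "continuation R f (Run b n) C = (f (Run b (Suc n)) + f (Run b 0)) / 2"
| "continuation R f (Run b n) Q = risk R b n * f (Done b) + (1 - risk R b n) * f (Run (\<not> b) 0)"
| "continuation R f (Done b) x = f (Done b)"

fun update :: "belief \<Rightarrow> action \<Rightarrow> signal \<Rightarrow> belief" where
  "update (Run b n) C D = Run b (Suc n)"
| "update (Run b n) C D' = Run b 0"
| "update (Run b n) Q D = Run (\<not> b) 0"
| "update (Run b n) Q D' = Done b"
| "update (Done b) x a = Done b"

fun signal_law :: "(bool \<Rightarrow> nat) \<Rightarrow> belief \<Rightarrow> action \<Rightarrow> signal pmf" where
  "signal_law R (Run b n) C = map_pmf (\<lambda>x. if x then D else D') (bernoulli_pmf (1 / 2))"
| "signal_law R (Run b n) Q = map_pmf (\<lambda>x. if x then D' else D) (bernoulli_pmf (risk R b n))"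
| "signal_law R (Done b) x = return_pmf D"

lemma expectation_signal_law:
  "measure_pmf.expectation (signal_law R s x) (\<lambda>a. f (update s x a)) = continuation R f s x"
  using risk_bounds[of R]
  by (cases "(R, s, x)" rule: signal_law.cases) (auto simp: less_imp_le)

definition counter_state :: "bool \<Rightarrow> nat \<Rightarrow> state" where
  "counter_state b l = (if b then One_T l else Zero_T l)"

definition plus_state :: "bool \<Rightarrow> state" where
  "plus_state b = (if b then One_plus else Zero_plus)"

definition star_state :: "bool \<Rightarrow> state" where
  "star_state b = (if b then One_star else Zero_star)"

fun belief_law :: "(bool \<Rightarrow> nat) \<Rightarrow> belief \<Rightarrow> state pmf" where
  "belief_law R (Run b n) =
     map_pmf (\<lambda>x. if x then counter_state b (n mod R b) else plus_state b)
       (bernoulli_pmf (risk R b n))"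
| "belief_law R (Done b) = return_pmf (star_state b)"

definition period :: "nat \<Rightarrow> bool \<Rightarrow> nat" where
  "period r b = (if b then 2 * r else r)"

definition controller :: "belief \<Rightarrow> action \<Rightarrow> action \<Rightarrow> action" where
  "controller s i j = (if side s then j else i)"

text \<open>Apart from the period the two sides have the same transitions, with \<open>x\<close> the action of the
  player who controls side \<open>b\<close>.\<close>

lemma Gamma_transition_sides:
  assumes x: "x = (if b then j else i)"
  shows "Gamma_transition r (counter_state b l) i j =
    (if x = Q then return_pmf (star_state b, D')
     else if l + 1 < period r b
     then pmf_of_list [((counter_state b (l + 1), D), 1/2), ((counter_state b 0, D'), 1/2)]
     else pmf_of_list [((counter_state b 0, D), (1/2) ^ period r b / 2),
       ((plus_state b, D), (1 - (1/2) ^ period r b) / 2), ((counter_state b 0, D'), 1/2)])"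
   and "Gamma_transition r (plus_state b) i j =
    (if x = Q then return_pmf (counter_state (\<not> b) 0, D)
     else pmf_of_list [((plus_state b, D), 1/2), ((counter_state b 0, D'), 1/2)])"
   and "Gamma_transition r (star_state b) i j = return_pmf (star_state b, D)"
  unfolding x counter_state_def plus_state_def star_state_def period_def
  by (cases i; cases j; simp)+

lemma state_distinct [simp]:
  "counter_state b l \<noteq> plus_state b'" "plus_state b' \<noteq> counter_state b l"
  "counter_state b l \<noteq> star_state b'" "star_state b' \<noteq> counter_state b l"
  "plus_state b \<noteq> star_state b'" "star_state b' \<noteq> plus_state b"
  "counter_state b l = counter_state b' l' \<longleftrightarrow> b = b' \<and> l = l'"
  by (auto simp: counter_state_def plus_state_def star_state_def)

lemma pmf_bind_map_bernoulli:
  assumes "0 \<le> p" "p \<le> 1"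
  shows "pmf (bind_pmf (map_pmf f (bernoulli_pmf p)) g) z =
    p * pmf (g (f True)) z + (1 - p) * pmf (g (f False)) z"
  using assms by (simp add: bind_map_pmf pmf_bind)

lemma pmf_map_map_bernoulli:
  assumes "0 \<le> p" "p \<le> 1"
  shows "pmf (map_pmf g (map_pmf f (bernoulli_pmf p))) z =
    (if g (f True) = z then p else 0) + (if g (f False) = z then 1 - p else 0)"
  using assms by (simp add: map_pmf_def bind_assoc_pmf bind_return_pmf pmf_bind indicator_def)

lemma belief_law_0: "belief_law R (Run b 0) = return_pmf (counter_state b 0)"
proof -
  have "bernoulli_pmf 1 = return_pmf True"
    by (rule pmf_eqI) (simp add: indicator_def split: bool.splits)
  then show ?thesis
    by (simp add: risk_def)
qed

text \<open>Bayes' rule: drawing the state from the belief and then moving amounts to drawing the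
  signal first and then the new state from the updated belief.  At the end of a period the mass
  \<open>risk\<close> on the last counting state splits: a fraction \<open>2 ^ (- R b)\<close> of what shows \<open>D\<close> starts a
  new period, and the rest joins the state \<open>+\<close>.\<close>

lemma belief_update:
  assumes "r \<ge> 1"
  shows "bind_pmf (belief_law (period r) s) (\<lambda>k. Gamma_transition r k i j) =
    bind_pmf (signal_law (period r) s (controller s i j))
      (\<lambda>a. map_pmf (\<lambda>k. (k, a)) (belief_law (period r) (update s (controller s i j) a)))"
proof (cases s)
  case (Done b)
  then show ?thesis
    by (simp add: bind_return_pmf Gamma_transition_sides)
next
  case (Run b n)
  let ?R = "period r b" and ?\<rho> = "risk (period r) b n"
  have R: "?R \<noteq> 0"
    using assms by (simp add: period_def)
  define x where "x = (if b then j else i)"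
  have x: "controller s i j = x"
    by (simp add: x_def controller_def Run)
  note T = Gamma_transition_sides[OF x_def]
  note B = pmf_bind_map_bernoulli pmf_map_map_bernoulli
  note wf = Gamma_weights_wf
  have \<rho>: "0 \<le> ?\<rho>" "?\<rho> \<le> 1"
    using risk_bounds[of "period r" b n] by auto
  show ?thesis
  proof (cases x)
    case Q
    have "pmf (bind_pmf (belief_law (period r) (Run b n)) (\<lambda>k. Gamma_transition r k i j)) z =
        pmf (bind_pmf (signal_law (period r) (Run b n) Q)
          (\<lambda>a. map_pmf (\<lambda>k. (k, a)) (belief_law (period r) (update (Run b n) Q a)))) z" for z
      using \<rho> unfolding belief_law.simps(1)[of _ b n] signal_law.simps B[OF \<rho>]
      by (simp add: T Q belief_law_0 del: belief_law.simps(1))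
    then show ?thesis
      unfolding x unfolding Run Q by (intro pmf_eqI)
  next
    case C
    have law_Suc: "belief_law (period r) (Run b (Suc n)) =
      (if n mod ?R + 1 < ?R then
         map_pmf (\<lambda>x. if x then counter_state b (n mod ?R + 1) else plus_state b) (bernoulli_pmf ?\<rho>)
       else map_pmf (\<lambda>x. if x then counter_state b 0 else plus_state b)
         (bernoulli_pmf (?\<rho> * (1 / 2) ^ ?R)))"
    proof (cases "n mod ?R + 1 < ?R")
      case True
      then have "Suc n mod ?R = n mod ?R + 1" "Suc n div ?R = n div ?R"
        by (auto simp: mod_Suc div_Suc)
      with True show ?thesis
        by (simp add: risk_def cong: if_cong)
    next
      case False
      moreover have "n mod ?R < ?R"
        using R by simp
      ultimately have "Suc (n mod ?R) = ?R"
        by simp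
      then have "Suc n mod ?R = 0" "Suc n div ?R = Suc (n div ?R)"
        by (auto simp: mod_Suc div_Suc)
      with False show ?thesis
        by (simp add: risk_def power_add mult.commute cong: if_cong)
    qed
    have half: "0 \<le> (1/2::real)" "(1/2::real) \<le> 1" by auto
    have \<rho>': "0 \<le> ?\<rho> * (1 / 2) ^ ?R" "?\<rho> * (1 / 2) ^ ?R \<le> 1"
      using \<rho> by (auto intro!: mult_le_one power_le_one)
    have "pmf (bind_pmf (belief_law (period r) (Run b n)) (\<lambda>k. Gamma_transition r k i j)) z =
        pmf (bind_pmf (signal_law (period r) (Run b n) C)
          (\<lambda>a. map_pmf (\<lambda>k. (k, a)) (belief_law (period r) (update (Run b n) C a)))) z" for z
      unfolding belief_law.simps(1)[of _ b n] signal_law.simps B(1)[OF \<rho>] B(1)[OF half]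
      using R
      by (simp add: T C belief_law_0 law_Suc pmf_pmf_of_list wf B(2)[OF \<rho>] B(2)[OF \<rho>']
           del: belief_law.simps(1)) (auto simp: field_simps)
    then show ?thesis
      unfolding x unfolding Run C by (intro pmf_eqI)
  qed
qed

section \<open>Dynamic programming on beliefs\<close>

abbreviation reward :: "belief \<Rightarrow> real" where
  "reward s \<equiv> of_bool (side s)"

definition opt :: "(bool \<Rightarrow> nat) \<Rightarrow> (belief \<Rightarrow> real) \<Rightarrow> belief \<Rightarrow> real" where
  "opt R f s = (if side s then min (continuation R f s C) (continuation R f s Q)
                else max (continuation R f s C) (continuation R f s Q))"

lemma opt_cases [simp]:
  "opt R f (Run True n) = min (continuation R f (Run True n) C) (continuation R f (Run True n) Q)"
  "opt R f (Run False n) = max (continuation R f (Run False n) C) (continuation R f (Run False n) Q)"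
  "opt R f (Done b) = f (Done b)"
  by (simp_all add: opt_def)

lemma continuation_mono:
  assumes "\<And>s. f s \<le> g s"
  shows "continuation R f s x \<le> continuation R g s x"
  using risk_bounds[of R] assms
  by (cases "(R, f, s, x)" rule: continuation.cases)
     (auto intro!: add_mono mult_left_mono divide_right_mono simp: less_imp_le)

lemma opt_mono: "(\<And>s. f s \<le> g s) \<Longrightarrow> opt R f s \<le> opt R g s"
  using continuation_mono[of f g R s C] continuation_mono[of f g R s Q] unfolding opt_def by auto

lemma continuation_add_const: "continuation R (\<lambda>s. f s + c) s x = continuation R f s x + c"
  by (cases "(R, f, s, x)" rule: continuation.cases) (auto simp: field_simps)

lemma opt_add_const: "opt R (\<lambda>s. f s + c) s = opt R f s + c"
  by (simp add: opt_def continuation_add_const min_add_distrib_left max_add_distrib_left)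

lemma opt_scale:
  assumes "0 \<le> c"
  shows "opt R (\<lambda>s. c * f s) s = c * opt R f s"
proof -
  have "continuation R (\<lambda>s. c * f s) s x = c * continuation R f s x" for x
    by (cases "(R, f, s, x)" rule: continuation.cases) (auto simp: field_simps)
  then show ?thesis
    using assms by (simp add: opt_def min_mult_distrib_left max_mult_distrib_left)
qed

lemma opt_nonexpansive:
  assumes "\<And>s. \<bar>f s - g s\<bar> \<le> c"
  shows "\<bar>opt R f s - opt R g s\<bar> \<le> c"
proof -
  have "f s \<le> g s + c" "g s \<le> f s + c" for s
    using assms[of s] by auto
  then have "opt R f s \<le> opt R (\<lambda>s. g s + c) s" "opt R g s \<le> opt R (\<lambda>s. f s + c) s"
    by (auto intro: opt_mono)
  then show ?thesis
    by (simp add: opt_add_const abs_le_iff)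
qed

fun flip :: "belief \<Rightarrow> belief" where
  "flip (Run b n) = Run (\<not> b) n"
| "flip (Done b) = Done (\<not> b)"

text \<open>Exchanging the sides and the roles of the players exchanges the periods and turns a payoff
  into its complement.  Through this symmetry every estimate for Player 1 also holds for Player 2.\<close>

lemma opt_flip: "opt R (\<lambda>s. c - f (flip s)) s = c - opt (\<lambda>b. R (\<not> b)) f (flip s)"
proof -
  have "continuation R (\<lambda>s. c - f (flip s)) s x = c - continuation (\<lambda>b. R (\<not> b)) f (flip s) x" for x
    by (cases "(R, f, s, x)" rule: continuation.cases) (auto simp: field_simps risk_def)
  moreover have "side (flip s) = (\<not> side s)"
    by (cases s) auto
  ultimately show ?thesis
    by (auto simp: opt_def)
qed

text \<open>The Shapley operator for the sum of the payoffs.\<close>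

definition stage_op :: "(bool \<Rightarrow> nat) \<Rightarrow> (belief \<Rightarrow> real) \<Rightarrow> belief \<Rightarrow> real" where
  "stage_op R f s = reward s + opt R f s"

primrec total_value :: "(bool \<Rightarrow> nat) \<Rightarrow> nat \<Rightarrow> belief \<Rightarrow> real" where
  "total_value R 0 = (\<lambda>s. 0)"
| "total_value R (Suc n) = stage_op R (total_value R n)"

lemma total_Done: "total_value R n (Done b) = of_bool b * n"
  by (induction n) (auto simp: stage_op_def)

text \<open>One more stage adds a payoff between \<open>0\<close> and \<open>1\<close> at the end of the game.\<close>

lemma total_increment: "total_value R n s \<le> total_value R (Suc n) s \<and> total_value R (Suc n) s \<le> total_value R n s + 1"
proof (induction n arbitrary: s)
  case 0
  show ?case
    by (cases s; cases "side s") (auto simp: stage_op_def opt_def)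
next
  case (Suc n)
  have "opt R (total_value R n) s \<le> opt R (total_value R (Suc n)) s"
    using Suc by (intro opt_mono) blast
  moreover have "opt R (total_value R (Suc n)) s \<le> opt R (\<lambda>s. total_value R n s + 1) s"
    using Suc by (intro opt_mono) blast
  ultimately show ?case
    by (simp add: stage_op_def opt_add_const)
qed

lemma total_bounds: "0 \<le> total_value R n s" "total_value R n s \<le> n"
proof -
  have "0 \<le> total_value R n s \<and> total_value R n s \<le> n"
  proof (induction n)
    case (Suc n)
    then show ?case
      using total_increment[of R n s] by (simp del: total_value.simps(2))
  qed simp
  then show "0 \<le> total_value R n s" "total_value R n s \<le> n" by auto
qed

lemma total_flip: "total_value R n s = n - total_value (\<lambda>b. R (\<not> b)) n (flip s)"
proof (induction n arbitrary: s)
  case (Suc n)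
  have "total_value R n = (\<lambda>s. n - total_value (\<lambda>b. R (\<not> b)) n (flip s))"
    using Suc by blast
  then have "opt R (total_value R n) s = n - opt (\<lambda>b. R (\<not> b)) (total_value (\<lambda>b. R (\<not> b)) n) (flip s)"
    by (metis opt_flip)
  then show ?case
    by (cases s) (auto simp: stage_op_def)
qed auto

lemma risk_antimono: "m \<le> n \<Longrightarrow> risk R b n \<le> risk R b m"
  unfolding risk_def by (intro power_decreasing mult_le_mono2 div_le_mono) auto

lemma total_False_mono:
  "total_value R n (Run False k) \<le> total_value R n (Run False (Suc k))"
proof (induction n arbitrary: k)
  case (Suc n)
  have "(1 - risk R False k) * total_value R n (Run True 0) \<le>
      (1 - risk R False (Suc k)) * total_value R n (Run True 0)"
    using risk_antimono[of k "Suc k"] total_bounds by (intro mult_right_mono) auto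
  then show ?case
    using Suc[of k] Suc[of "Suc k"]
    by (auto simp: stage_op_def total_Done intro!: max.mono simp del: max.bounded_iff)
qed auto

text \<open>A longer run of \<open>D\<close> only reduces the risk of Player 1, so the first state is the worst belief
  of the side \<open>0\<close>.  No belief of that side is better than the first state of the side \<open>1\<close>, because
  no reward is collected before that state is reached.\<close>

lemma total_sandwich_False:
  "total_value R n (Run False 0) \<le> total_value R n (Run False k)"
  "total_value R n (Run False k) \<le> total_value R n (Run True 0)"
proof -
  show "total_value R n (Run False 0) \<le> total_value R n (Run False k)"
    by (rule lift_Suc_mono_le) (auto intro: total_False_mono)
  show "total_value R n (Run False k) \<le> total_value R n (Run True 0)"
  proof (induction n arbitrary: k)
    case (Suc n)
    have "(1 - risk R False k) * total_value R n (Run True 0) \<le> total_value R n (Run True 0)"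
      using risk_bounds[of R False k] total_bounds by (intro mult_left_le_one_le) auto
    then have "total_value R (Suc n) (Run False k) \<le> total_value R n (Run True 0)"
      using Suc[of "Suc k"] Suc[of 0] by (auto simp: stage_op_def total_Done)
    also have "\<dots> \<le> total_value R (Suc n) (Run True 0)"
      using total_increment by blast
    finally show ?case .
  qed auto
qed

lemma total_sandwich:
  "total_value R n (Run False 0) \<le> total_value R n (Run b k)"
  "total_value R n (Run b k) \<le> total_value R n (Run True 0)"
proof -
  note F = total_sandwich_False[of R n k]
  have T: "total_value R n (Run True k) \<le> total_value R n (Run True 0)"
    "total_value R n (Run False 0) \<le> total_value R n (Run True k)"
    using total_sandwich_False[of "\<lambda>b. R (\<not> b)" n k]
      total_flip[of R n "Run True k"] total_flip[of R n "Run True 0"] total_flip[of R n "Run False 0"]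
    by auto
  show "total_value R n (Run False 0) \<le> total_value R n (Run b k)"
    "total_value R n (Run b k) \<le> total_value R n (Run True 0)"
    using F T by (cases b; simp)+
qed

text \<open>Player 1 can wait on the side \<open>0\<close> until the belief is \<open>Run False k\<close> and then quit.  This loses at
  most the risk of absorption and the expected waiting time, which is at most \<open>2 ^ (k + 1)\<close>
  whatever the number of stages is.\<close>

lemma total_gap:
  "total_value R n (Run True 0) - total_value R n (Run False 0) \<le> risk R False k * n + 2 ^ (k + 1)"
proof -
  let ?z = "\<lambda>j. total_value R n (Run False j)" and ?x = "total_value R n (Run True 0)"
  have step: "?z j \<ge> (?z (Suc j) + ?z 0) / 2 - 1" for j
  proof -
    have "(?z (Suc j) + ?z 0) / 2 \<le> total_value R (Suc n) (Run False j)"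
      by (simp add: stage_op_def)
    then show ?thesis
      using total_increment[of R n "Run False j"] by linarith
  qed
  have "?z k \<ge> ?x - risk R False k * ?x - 1"
    using total_increment[of R n "Run False k"] by (simp add: stage_op_def total_Done left_diff_distrib)
  moreover have wait: "?z j \<le> ?z 0 + 2 ^ (j + 1) - 2" for j
  proof (induction j)
    case (Suc j)
    moreover have "(2::real) ^ (Suc j + 1) = 2 * 2 ^ (j + 1)"
      by simp
    moreover have "?z (Suc j) \<le> 2 * ?z j - ?z 0 + 2"
      using step[of j] by (simp add: field_simps)
    ultimately show ?case
      by linarith
  qed simp
  moreover have "risk R False k * ?x \<le> risk R False k * n"
    using risk_bounds(1)[of R False k] total_bounds by (intro mult_left_mono) auto
  ultimately show ?thesis
    using wait[of k] by linarith
qed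

text \<open>The fixed points of the Shapley operator of the discounted game, normalised so that the payoffs
  have total weight \<open>1\<close>.\<close>

definition discounted_solution :: "(bool \<Rightarrow> nat) \<Rightarrow> real \<Rightarrow> (belief \<Rightarrow> real) \<Rightarrow> bool" where
  "discounted_solution R l v \<longleftrightarrow>
     (\<forall>s. v s = l * reward s + (1 - l) * opt R v s) \<and> (\<forall>s. 0 \<le> v s \<and> v s \<le> 1)"

lemma discounted_solutionD:
  assumes "discounted_solution R l v"
  shows "v s = l * reward s + (1 - l) * opt R v s" "0 \<le> v s" "v s \<le> 1"
  using assms unfolding discounted_solution_def by blast+

lemma opt_tendsto:
  assumes "\<And>s. (\<lambda>n. f n s) \<longlonglongrightarrow> g s"
  shows "(\<lambda>n. opt R (f n) s) \<longlonglongrightarrow> opt R g s"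
proof -
  have "(\<lambda>n. continuation R (f n) s x) \<longlonglongrightarrow> continuation R g s x" for x
    by (cases "(R, g, s, x)" rule: continuation.cases) (auto intro!: tendsto_intros assms)
  then show ?thesis
    by (auto simp: opt_def intro!: tendsto_min tendsto_max)
qed

text \<open>The iterates of the discounted Shapley operator starting from \<open>0\<close> increase and are bounded by \<open>1\<close>.
  Their limit is a fixed point because the operator looks at finitely many beliefs at a time.\<close>

lemma discounted_solution_exists:
  assumes l: "0 < l" "l < 1"
  shows "\<exists>v. discounted_solution R l v"
proof -
  define T where "T f s = l * reward s + (1 - l) * opt R f s" for f s
  define u where "u n = (T ^^ n) (\<lambda>s. 0)" for n
  have u_Suc: "u (Suc n) = T (u n)" for n
    by (simp add: u_def)
  have T_mono: "T f s \<le> T g s" if "\<And>s. f s \<le> g s" for f g s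
    unfolding T_def using l opt_mono[OF that] by (intro add_left_mono mult_left_mono) auto
  have opt_const: "opt R (\<lambda>s. c) s = c" for c s
    using opt_add_const[of R "\<lambda>s. 0" c s] by (cases s; cases "side s") (auto simp: opt_def)
  have inc: "u n s \<le> u (Suc n) s" for n s
  proof (induction n arbitrary: s)
    case 0
    have "0 \<le> T (\<lambda>s. 0) s"
      unfolding T_def opt_const using l by auto
    then show ?case
      by (simp add: u_def)
  next
    case (Suc n)
    then show ?case
      unfolding u_Suc[of n] u_Suc[of "Suc n"] by (intro T_mono)
  qed
  have le1: "u n s \<le> 1" for n s
  proof (induction n arbitrary: s)
    case (Suc n)
    have "u (Suc n) s \<le> T (\<lambda>s. 1) s"
      unfolding u_Suc by (intro T_mono Suc)
    also have "\<dots> \<le> 1"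
      unfolding T_def opt_const using l by auto
    finally show ?case .
  qed (simp add: u_def)
  have ge0: "0 \<le> u n s" for n s
    using lift_Suc_mono_le[of "\<lambda>n. u n s" 0 n] inc by (simp add: u_def)
  have conv: "\<exists>a. (\<lambda>n. u n s) \<longlonglongrightarrow> a" for s
    using incseq_convergent[of "\<lambda>n. u n s" 1] inc le1 by (metis incseq_SucI)
  then obtain v where v: "\<And>s. (\<lambda>n. u n s) \<longlonglongrightarrow> v s"
    by metis
  have "v s = l * reward s + (1 - l) * opt R v s" for s
  proof -
    have "(\<lambda>n. u (Suc n) s) \<longlonglongrightarrow> l * reward s + (1 - l) * opt R v s"
      unfolding u_Suc T_def by (intro tendsto_intros opt_tendsto v)
    moreover have "(\<lambda>n. u (Suc n) s) \<longlonglongrightarrow> v s"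
      using v[of s] by (rule LIMSEQ_Suc)
    ultimately show ?thesis
      by (rule LIMSEQ_unique[rotated])
  qed
  moreover have "0 \<le> v s \<and> v s \<le> 1" for s
    using v[of s] ge0 le1 by (meson LIMSEQ_le_const LIMSEQ_le_const2)
  ultimately show ?thesis
    unfolding discounted_solution_def by blast
qed

lemma discounted_solution_flip:
  assumes "discounted_solution R l v"
  shows "discounted_solution (\<lambda>b. R (\<not> b)) l (\<lambda>s. 1 - v (flip s))"
  unfolding discounted_solution_def
proof (intro conjI allI)
  fix s
  have "v (flip s) = l * reward (flip s) + (1 - l) * opt R v (flip s)"
    by (rule discounted_solutionD(1)[OF assms])
  moreover have "reward (flip s) = 1 - reward s"
    by (cases s) auto
  ultimately show "1 - v (flip s) =
      l * reward s + (1 - l) * opt (\<lambda>b. R (\<not> b)) (\<lambda>s. 1 - v (flip s)) s"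
    by (simp add: opt_flip algebra_simps)
next
  show "0 \<le> 1 - v (flip s)" "1 - v (flip s) \<le> 1" for s
    using discounted_solutionD(2,3)[OF assms, of "flip s"] by linarith+
qed

section \<open>The values of the games\<close>

definition public_belief :: "belief \<Rightarrow> (action, action, signal) history \<Rightarrow> belief" where
  "public_belief s h = foldl (\<lambda>s (i, j, a). update s (controller s i j) a) s h"

lemma public_belief_simps [simp]:
  "public_belief s [] = s"
  "public_belief s (h @ [(i, j, a)]) =
     update (public_belief s h) (controller (public_belief s h) i j) a"
  by (simp_all add: public_belief_def)

primrec history_law ::
    "(bool \<Rightarrow> nat) \<Rightarrow> (action, action, signal) strategy1 \<Rightarrow> (action, action, signal) strategy2 \<Rightarrow>
     belief \<Rightarrow> nat \<Rightarrow> (action, action, signal) history pmf" where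
  "history_law R \<sigma> \<tau> s 0 = return_pmf []"
| "history_law R \<sigma> \<tau> s (Suc m) =
     bind_pmf (history_law R \<sigma> \<tau> s m) (\<lambda>h.
       bind_pmf (\<sigma> h) (\<lambda>i. bind_pmf (\<tau> h) (\<lambda>j.
         map_pmf (\<lambda>a. h @ [(i, j, a)])
           (signal_law R (public_belief s h) (controller (public_belief s h) i j)))))"

text \<open>Given the public history, the state is distributed according to the public belief, whatever
  the strategies are: the strategies depend on the history only, so the draws of the actions commute
  with the draw of the state, and \<open>belief_update\<close> applies.\<close>

lemma prefix_law_Gamma:
  assumes "r \<ge> 1"
  shows "prefix_law (Gamma_game r) (belief_law (period r) s) \<sigma> \<tau> m =
    bind_pmf (history_law (period r) \<sigma> \<tau> s m)
      (\<lambda>h. map_pmf (Pair h) (belief_law (period r) (public_belief s h)))"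
proof (induction m)
  case 0
  show ?case
    by (simp add: bind_return_pmf)
next
  case (Suc m)
  let ?H = "history_law (period r) \<sigma> \<tau> s m"
  let ?L = "\<lambda>h. belief_law (period r) (public_belief s h)"
  let ?x = "\<lambda>h i j. controller (public_belief s h) i j"
  have step: "bind_pmf (?L h) (\<lambda>k. map_pmf (\<lambda>z. (h @ [public_part z], next_state z))
        (stage_law (Gamma_game r) \<sigma> \<tau> h k)) =
      bind_pmf (\<sigma> h) (\<lambda>i. bind_pmf (\<tau> h) (\<lambda>j.
        bind_pmf (signal_law (period r) (public_belief s h) (?x h i j)) (\<lambda>a.
          map_pmf (Pair (h @ [(i, j, a)])) (?L (h @ [(i, j, a)])))))" for h
  proof -
    have "bind_pmf (?L h) (\<lambda>k. map_pmf (\<lambda>z. (h @ [public_part z], next_state z))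
        (stage_law (Gamma_game r) \<sigma> \<tau> h k)) =
      bind_pmf (?L h) (\<lambda>k. bind_pmf (\<sigma> h) (\<lambda>i. bind_pmf (\<tau> h) (\<lambda>j.
        map_pmf (\<lambda>(k', a). (h @ [(i, j, a)], k')) (Gamma_transition r k i j))))"
      by (simp add: stage_law_def map_bind_pmf map_pmf_comp case_prod_unfold public_part_def
            next_state_def Gamma_game_def)
    also have "\<dots> = bind_pmf (\<sigma> h) (\<lambda>i. bind_pmf (\<tau> h) (\<lambda>j. bind_pmf (?L h) (\<lambda>k.
        map_pmf (\<lambda>(k', a). (h @ [(i, j, a)], k')) (Gamma_transition r k i j))))"
      by (subst bind_commute_pmf, subst (2) bind_commute_pmf) (rule refl)
    also have "\<dots> = bind_pmf (\<sigma> h) (\<lambda>i. bind_pmf (\<tau> h) (\<lambda>j.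
        map_pmf (\<lambda>(k', a). (h @ [(i, j, a)], k'))
          (bind_pmf (?L h) (\<lambda>k. Gamma_transition r k i j))))"
      by (simp add: map_bind_pmf)
    finally show ?thesis
      by (simp add: belief_update[OF assms] map_bind_pmf map_pmf_comp)
  qed
  have "prefix_law (Gamma_game r) (belief_law (period r) s) \<sigma> \<tau> (Suc m) =
      bind_pmf ?H (\<lambda>h. bind_pmf (?L h) (\<lambda>k. map_pmf (\<lambda>z. (h @ [public_part z], next_state z))
        (stage_law (Gamma_game r) \<sigma> \<tau> h k)))"
    by (simp add: Suc bind_assoc_pmf bind_map_pmf)
  also have "\<dots> = bind_pmf (history_law (period r) \<sigma> \<tau> s (Suc m)) (\<lambda>h. map_pmf (Pair h) (?L h))"
    unfolding step by (simp add: bind_assoc_pmf bind_map_pmf)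
  finally show ?case .
qed

lemma Gamma_payoff_eq: "Gamma_payoff k i j = Gamma_payoff k C C"
  by (cases "(k, i, j)" rule: Gamma_payoff.cases) auto

lemma Gamma_payoff_belief_law: "k \<in> set_pmf (belief_law R s) \<Longrightarrow> Gamma_payoff k C C = reward s"
  by (cases s) (auto simp: counter_state_def plus_state_def star_state_def split: if_splits)

definition expected :: "(bool \<Rightarrow> nat) \<Rightarrow> (action, action, signal) strategy1 \<Rightarrow>
    (action, action, signal) strategy2 \<Rightarrow> belief \<Rightarrow> nat \<Rightarrow> (belief \<Rightarrow> real) \<Rightarrow> real" where
  "expected R \<sigma> \<tau> s m f =
     measure_pmf.expectation (history_law R \<sigma> \<tau> s m) (\<lambda>h. f (public_belief s h))"

lemma expectation_Gamma_payoff: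
  assumes "r \<ge> 1"
  shows "measure_pmf.expectation (prefix_law (Gamma_game r) (belief_law (period r) s) \<sigma> \<tau> m)
      (\<lambda>(h, k). Gamma_payoff k C C) = expected (period r) \<sigma> \<tau> s m reward"
proof -
  let ?H = "history_law (period r) \<sigma> \<tau> s m"
  let ?L = "\<lambda>h. belief_law (period r) (public_belief s h)"
  have "map_pmf (\<lambda>(h, k). Gamma_payoff k C C)
      (prefix_law (Gamma_game r) (belief_law (period r) s) \<sigma> \<tau> m) =
      bind_pmf ?H (\<lambda>h. map_pmf (\<lambda>k. Gamma_payoff k C C) (?L h))"
    by (simp add: prefix_law_Gamma[OF assms] map_bind_pmf map_pmf_comp)
  also have "\<dots> = bind_pmf ?H (\<lambda>h. return_pmf (reward (public_belief s h)))"
  proof (intro bind_pmf_cong refl)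
    fix h
    have "map_pmf (\<lambda>k. Gamma_payoff k C C) (?L h) = map_pmf (\<lambda>_. reward (public_belief s h)) (?L h)"
      by (intro map_pmf_cong refl Gamma_payoff_belief_law)
    then show "map_pmf (\<lambda>k. Gamma_payoff k C C) (?L h) = return_pmf (reward (public_belief s h))"
      by simp
  qed
  finally have "map_pmf (\<lambda>(h, k). Gamma_payoff k C C)
      (prefix_law (Gamma_game r) (belief_law (period r) s) \<sigma> \<tau> m) =
      map_pmf (\<lambda>h. reward (public_belief s h)) ?H"
    by (simp add: map_pmf_def)
  then have "measure_pmf.expectation (map_pmf (\<lambda>(h, k). Gamma_payoff k C C)
      (prefix_law (Gamma_game r) (belief_law (period r) s) \<sigma> \<tau> m)) (\<lambda>x. x) =
      measure_pmf.expectation (map_pmf (\<lambda>h. reward (public_belief s h)) ?H) (\<lambda>x. x)"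
    by simp
  then show ?thesis
    unfolding integral_map_pmf expected_def .
qed

lemma payoff_n_Gamma:
  assumes "r \<ge> 1"
  shows "payoff_n (Gamma_game r) n (belief_law (period r) s) \<sigma> \<tau> =
    (\<Sum>m<n. 1 / real n * expected (period r) \<sigma> \<tau> s m reward)"
proof -
  have u: "payoff (Gamma_game r) k i j = Gamma_payoff k C C" "0 \<le> Gamma_payoff k C C"
    "Gamma_payoff k C C \<le> 1" for k i j
    using Gamma_payoff_eq[of k i j] by (simp add: Gamma_game_def, (cases k; simp)+)
  show ?thesis
    unfolding expectation_Gamma_payoff[OF assms, symmetric]
    by (rule payoff_n_state_payoff[where u = "\<lambda>k. Gamma_payoff k C C", OF u])
qed

lemma payoff_disc_Gamma:
  assumes "r \<ge> 1" and l: "0 < l" "l \<le> 1"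
  shows "(\<lambda>m. l * (1 - l) ^ m * expected (period r) \<sigma> \<tau> s m reward)
    sums payoff_disc (Gamma_game r) l (belief_law (period r) s) \<sigma> \<tau>"
proof -
  have u: "payoff (Gamma_game r) k i j = Gamma_payoff k C C" "0 \<le> Gamma_payoff k C C"
    "Gamma_payoff k C C \<le> 1" for k i j
    using Gamma_payoff_eq[of k i j] by (simp add: Gamma_game_def, (cases k; simp)+)
  show ?thesis
    unfolding expectation_Gamma_payoff[OF assms(1), symmetric]
    by (rule payoff_disc_state_payoff[where u = "\<lambda>k. Gamma_payoff k C C", OF u l])
qed

lemma finite_history_law: "finite (set_pmf (history_law R \<sigma> \<tau> s m))"
  by (induction m) auto

lemma length_history_law: "h \<in> set_pmf (history_law R \<sigma> \<tau> s m) \<Longrightarrow> length h = m"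
  by (induction m arbitrary: h) auto

lemma expectation_bind_finite:
  fixes f :: "'b \<Rightarrow> real"
  assumes "finite (set_pmf p)" "\<And>x. x \<in> set_pmf p \<Longrightarrow> finite (set_pmf (q x))"
  shows "measure_pmf.expectation (bind_pmf p q) f =
    measure_pmf.expectation p (\<lambda>x. measure_pmf.expectation (q x) f)"
  using assms by (subst pmf_expectation_bind[where A = "set_pmf p"])
    (auto simp: integral_measure_pmf[where A = "set_pmf p"])

lemma expected_Suc:
  "expected R \<sigma> \<tau> s (Suc m) f =
     measure_pmf.expectation (history_law R \<sigma> \<tau> s m) (\<lambda>h.
       measure_pmf.expectation (\<sigma> h) (\<lambda>i. measure_pmf.expectation (\<tau> h) (\<lambda>j.
         continuation R f (public_belief s h) (controller (public_belief s h) i j))))"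
  unfolding expected_def history_law.simps
  by (subst expectation_bind_finite, simp_all add: finite_history_law)
     (subst expectation_bind_finite, simp_all,
      subst expectation_bind_finite, simp_all add: expectation_signal_law)

definition optimal_action :: "(bool \<Rightarrow> nat) \<Rightarrow> (belief \<Rightarrow> real) \<Rightarrow> belief \<Rightarrow> action" where
  "optimal_action R f s = (if continuation R f s C = opt R f s then C else Q)"

lemma continuation_optimal_action: "continuation R f s (optimal_action R f s) = opt R f s"
  by (auto simp: optimal_action_def opt_def min_def max_def)

lemma continuation_ge_opt: "side s \<Longrightarrow> opt R f s \<le> continuation R f s x"
  and continuation_le_opt: "\<not> side s \<Longrightarrow> continuation R f s x \<le> opt R f s"
  by (cases x; simp add: opt_def)+

text \<open>The same strategy serves both players, because only the action of the player who controls the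
  current side matters.  After a history of length \<open>m\<close> comes stage \<open>m\<close>, so the action is
  optimal against the continuation \<open>U (Suc m)\<close>.\<close>

definition greedy :: "(bool \<Rightarrow> nat) \<Rightarrow> (nat \<Rightarrow> belief \<Rightarrow> real) \<Rightarrow> belief \<Rightarrow>
    (action, action, signal) history \<Rightarrow> action pmf" where
  "greedy R U s h = return_pmf (optimal_action R (U (Suc (length h))) (public_belief s h))"

lemma expected_greedy_ge:
  "expected R (greedy R U s) \<tau> s m (opt R (U (Suc m)))
    \<le> expected R (greedy R U s) \<tau> s (Suc m) (U (Suc m))"
  unfolding expected_Suc unfolding expected_def
proof (rule integral_mono_AE)
  show "AE h in history_law R (greedy R U s) \<tau> s m. opt R (U (Suc m)) (public_belief s h) \<le>
      measure_pmf.expectation (greedy R U s h) (\<lambda>i. measure_pmf.expectation (\<tau> h) (\<lambda>j.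
        continuation R (U (Suc m)) (public_belief s h) (controller (public_belief s h) i j)))"
  proof (rule AE_pmfI)
    fix h assume "h \<in> set_pmf (history_law R (greedy R U s) \<tau> s m)"
    then have len: "length h = m"
      by (rule length_history_law)
    let ?s = "public_belief s h"
    let ?i = "optimal_action R (U (Suc m)) ?s"
    have "opt R (U (Suc m)) ?s \<le> continuation R (U (Suc m)) ?s (controller ?s ?i j)" for j
      by (simp add: controller_def continuation_ge_opt continuation_optimal_action)
    then show "opt R (U (Suc m)) ?s \<le> measure_pmf.expectation (greedy R U s h)
        (\<lambda>i. measure_pmf.expectation (\<tau> h) (\<lambda>j. continuation R (U (Suc m)) ?s (controller ?s i j)))"
      by (simp add: greedy_def len measure_pmf.integral_ge_const integrable_measure_pmf_finite)
  qed
qed (auto intro!: integrable_measure_pmf_finite finite_history_law)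

lemma expected_greedy_le:
  "expected R \<sigma> (greedy R U s) s (Suc m) (U (Suc m))
    \<le> expected R \<sigma> (greedy R U s) s m (opt R (U (Suc m)))"
  unfolding expected_Suc unfolding expected_def
proof (rule integral_mono_AE)
  show "AE h in history_law R \<sigma> (greedy R U s) s m.
      measure_pmf.expectation (\<sigma> h) (\<lambda>i. measure_pmf.expectation (greedy R U s h) (\<lambda>j.
        continuation R (U (Suc m)) (public_belief s h) (controller (public_belief s h) i j)))
      \<le> opt R (U (Suc m)) (public_belief s h)"
  proof (rule AE_pmfI)
    fix h assume "h \<in> set_pmf (history_law R \<sigma> (greedy R U s) s m)"
    then have len: "length h = m"
      by (rule length_history_law)
    let ?s = "public_belief s h"
    let ?j = "optimal_action R (U (Suc m)) ?s"
    have "continuation R (U (Suc m)) ?s (controller ?s i ?j) \<le> opt R (U (Suc m)) ?s" for i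
      by (simp add: controller_def continuation_le_opt continuation_optimal_action)
    then show "measure_pmf.expectation (\<sigma> h) (\<lambda>i. measure_pmf.expectation (greedy R U s h)
        (\<lambda>j. continuation R (U (Suc m)) ?s (controller ?s i j))) \<le> opt R (U (Suc m)) ?s"
      by (simp add: greedy_def len measure_pmf.integral_le_const integrable_measure_pmf_finite)
  qed
qed (auto intro!: integrable_measure_pmf_finite finite_history_law)

lemma expected_0: "expected R \<sigma> \<tau> s 0 f = f s"
  by (simp add: expected_def)

lemma expected_bellman:
  "expected R \<sigma> \<tau> s m (\<lambda>s. w * reward s + g s) =
    w * expected R \<sigma> \<tau> s m reward + expected R \<sigma> \<tau> s m g"
  unfolding expected_def
  by (subst Bochner_Integration.integral_add)
     (auto intro!: integrable_measure_pmf_finite finite_history_law)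

text \<open>If \<open>U m\<close> solves the dynamic programming equation in which stage \<open>m\<close> has weight \<open>w m\<close>, then the
  payoffs accumulated so far plus the expectation of \<open>U\<close> at the current belief do not decrease in
  expectation when Player 1 is greedy and do not increase when Player 2 is greedy.  The strategies do
  not depend on the horizon \<open>n\<close>, which allows \<open>n\<close> to tend to infinity in the discounted game.\<close>

lemma verification:
  assumes U: "\<And>m. m < n \<Longrightarrow> U m = (\<lambda>s. w m * reward s + opt R (U (Suc m)) s)"
  shows "U 0 s \<le> (\<Sum>m<n. w m * expected R (greedy R U s) \<tau> s m reward) +
      expected R (greedy R U s) \<tau> s n (U n)" (is ?A)
    and "(\<Sum>m<n. w m * expected R \<sigma> (greedy R U s) s m reward) +
      expected R \<sigma> (greedy R U s) s n (U n) \<le> U 0 s" (is ?B)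
proof -
  have eq: "expected R \<sigma> \<tau> s m (U m) =
      w m * expected R \<sigma> \<tau> s m reward + expected R \<sigma> \<tau> s m (opt R (U (Suc m)))"
    if "m < n" for \<sigma> \<tau> m
    by (subst U[OF that]) (rule expected_bellman)
  show ?A
    using eq
  proof (induction n)
    case (Suc n)
    then show ?case
      using Suc.prems[of n "greedy R U s" \<tau>] expected_greedy_ge[of R U s \<tau> n] by fastforce
  qed (simp add: expected_0)
  show ?B
    using eq
  proof (induction n)
    case (Suc n)
    then show ?case
      using Suc.prems[of n \<sigma> "greedy R U s"] expected_greedy_le[of R \<sigma> U s n] by fastforce
  qed (simp add: expected_0)
qed

lemma has_value_n_Gamma:
  assumes r: "r \<ge> 1" and n: "n \<ge> 1"
  shows "has_value (payoff_n (Gamma_game r) n (belief_law (period r) s)) (total_value (period r) n s / n)"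
proof -
  let ?R = "period r"
  define U where "U m s = 1 / n * total_value ?R (n - m) s" for m s
  have U: "U m = (\<lambda>s. 1 / n * reward s + opt ?R (U (Suc m)) s)" if "m < n" for m
  proof
    fix s
    have "n - m = Suc (n - Suc m)"
      using that by simp
    then have "U m s = 1 / n * reward s + 1 / n * opt ?R (total_value ?R (n - Suc m)) s"
      by (simp add: U_def stage_op_def add_divide_distrib)
    also have "1 / n * opt ?R (total_value ?R (n - Suc m)) s = opt ?R (U (Suc m)) s"
      unfolding U_def by (rule opt_scale[symmetric]) simp
    finally show "U m s = 1 / n * reward s + opt ?R (U (Suc m)) s" .
  qed
  have "U n = (\<lambda>s. 0)" "U 0 s = total_value ?R n s / n"
    by (simp_all add: U_def fun_eq_iff)
  then show ?thesis
    using verification[where n = n and U = U and s = s and R = ?R, OF U]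
    unfolding has_value_def payoff_n_Gamma[OF r] by (auto simp: expected_def)
qed

lemma has_value_disc_Gamma:
  assumes r: "r \<ge> 1" and l: "0 < l" "l < 1" and sol: "discounted_solution (period r) l v"
  shows "has_value (payoff_disc (Gamma_game r) l (belief_law (period r) s)) (v s)"
proof -
  let ?R = "period r"
  define U where "U m s = (1 - l) ^ m * v s" for m s
  have U: "U m = (\<lambda>s. l * (1 - l) ^ m * reward s + opt ?R (U (Suc m)) s)" for m
  proof
    fix s
    have "U m s = (1 - l) ^ m * (l * reward s + (1 - l) * opt ?R v s)"
      unfolding U_def using discounted_solutionD(1)[OF sol] by (rule arg_cong)
    also have "\<dots> = l * (1 - l) ^ m * reward s + (1 - l) ^ Suc m * opt ?R v s"
      by (simp add: algebra_simps)
    also have "(1 - l) ^ Suc m * opt ?R v s = opt ?R (U (Suc m)) s"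
      unfolding U_def using l by (intro opt_scale[symmetric]) simp
    finally show "U m s = l * (1 - l) ^ m * reward s + opt ?R (U (Suc m)) s" .
  qed
  have tail: "(\<lambda>n. expected ?R \<sigma> \<tau> s n (U n)) \<longlonglongrightarrow> 0" for \<sigma> \<tau>
  proof (rule Lim_null_comparison)
    show "\<forall>\<^sub>F n in sequentially. norm (expected ?R \<sigma> \<tau> s n (U n)) \<le> (1 - l) ^ n"
    proof (intro always_eventually allI)
      fix n
      have "norm (U n b) \<le> (1 - l) ^ n" for b
        using l discounted_solutionD(2,3)[OF sol, of b] by (simp add: U_def abs_mult mult_left_le)
      then show "norm (expected ?R \<sigma> \<tau> s n (U n)) \<le> (1 - l) ^ n"
        unfolding expected_def
        by (intro order_trans[OF integral_norm_bound] measure_pmf.integral_le_const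
             integrable_measure_pmf_finite finite_history_law) auto
    qed
    show "(\<lambda>n. (1 - l) ^ n) \<longlonglongrightarrow> 0"
      using l by (intro LIMSEQ_realpow_zero) auto
  qed
  have lim: "(\<lambda>n. (\<Sum>m<n. l * (1 - l) ^ m * expected ?R \<sigma> \<tau> s m reward) + expected ?R \<sigma> \<tau> s n (U n))
      \<longlonglongrightarrow> payoff_disc (Gamma_game r) l (belief_law ?R s) \<sigma> \<tau>" for \<sigma> \<tau>
    using tendsto_add[OF _ tail, of _ "payoff_disc (Gamma_game r) l (belief_law ?R s) \<sigma> \<tau>"]
      payoff_disc_Gamma[OF r l(1) less_imp_le[OF l(2)]]
    unfolding sums_def by fastforce
  note V = verification[where U = U and s = s and R = ?R, OF U]
  have "U 0 s = v s"
    by (simp add: U_def)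
  then have "v s \<le> payoff_disc (Gamma_game r) l (belief_law ?R s) (greedy ?R U s) \<tau>" for \<tau>
    using LIMSEQ_le_const[OF lim] V(1) by auto
  moreover have "payoff_disc (Gamma_game r) l (belief_law ?R s) \<sigma> (greedy ?R U s) \<le> v s" for \<sigma>
    using LIMSEQ_le_const2[OF lim] V(2) \<open>U 0 s = v s\<close> by auto
  ultimately show ?thesis
    unfolding has_value_def by blast
qed

lemma value_n_Gamma:
  assumes "r \<ge> 1" "n \<ge> 1"
  shows "value_n (Gamma_game r) n (belief_law (period r) s) = total_value (period r) n s / n"
  unfolding value_n_def using has_value_n_Gamma[OF assms]
  by (intro the_equality) (auto intro: has_value_unique)

lemma value_disc_Gamma:
  assumes "r \<ge> 1" "0 < l" "l < 1" "discounted_solution (period r) l v"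
  shows "value_disc (Gamma_game r) l (belief_law (period r) s) = v s"
  unfolding value_disc_def using has_value_disc_Gamma[OF assms]
  by (intro the_equality) (auto intro: has_value_unique)

section \<open>Oscillation of the discounted values\<close>

text \<open>Let \<open>z j\<close> be the values after \<open>j\<close> signals \<open>D\<close>, with \<open>y = z 0\<close>.  Waiting multiplies by the
  discounted probability \<open>t\<close> of each signal.  Summing the geometric series of the returns to \<open>y\<close>
  expresses \<open>y\<close> by the value \<open>z n\<close> at which the waiting ends, with an inequality if waiting need not
  be optimal.\<close>

lemma wait_recursion:
  fixes t y :: real and z :: "nat \<Rightarrow> real"
  assumes "z 0 = y"
  shows "(\<And>j. j < n \<Longrightarrow> z j = t * (z (Suc j) + y)) \<Longrightarrow>
      (1 - 2 * t + t ^ Suc n) * y = (1 - t) * t ^ n * z n"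
    and "0 \<le> t \<Longrightarrow> t \<le> 1 \<Longrightarrow> (\<And>j. j < n \<Longrightarrow> z j \<ge> t * (z (Suc j) + y)) \<Longrightarrow>
      (1 - 2 * t + t ^ Suc n) * y \<ge> (1 - t) * t ^ n * z n"
proof -
  assume *: "\<And>j. j < n \<Longrightarrow> z j = t * (z (Suc j) + y)"
  show "(1 - 2 * t + t ^ Suc n) * y = (1 - t) * t ^ n * z n"
    using *
  proof (induction n)
    case (Suc n)
    then have "(1 - 2 * t + t ^ Suc n) * y = (1 - t) * t ^ n * (t * (z (Suc n) + y))"
      by simp
    then show ?case
      by (simp add: algebra_simps)
  qed (simp add: assms algebra_simps)
next
  assume t: "0 \<le> t" "t \<le> 1" and *: "\<And>j. j < n \<Longrightarrow> z j \<ge> t * (z (Suc j) + y)"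
  show "(1 - 2 * t + t ^ Suc n) * y \<ge> (1 - t) * t ^ n * z n"
    using *
  proof (induction n)
    case (Suc n)
    have "(1 - t) * t ^ n * (t * (z (Suc n) + y)) \<le> (1 - t) * t ^ n * z n"
      using t Suc.prems[of n] by (intro mult_left_mono) auto
    also have "\<dots> \<le> (1 - 2 * t + t ^ Suc n) * y"
      using Suc by simp
    finally show ?case
      by (simp add: algebra_simps)
  qed (simp add: assms algebra_simps)
qed

text \<open>Multiplying the identities for \<open>t = (1 - l) / 2\<close> by \<open>2 ^ (n + 1)\<close> shows the factor \<open>l * 2 ^ n\<close>, the
  cost of waiting.\<close>

lemma wait_clear_denominators:
  fixes l y q :: real
  shows "2 * 2 ^ n * ((1 - 2 * ((1 - l) / 2) + ((1 - l) / 2) ^ Suc n) * y) =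
     (2 * l * 2 ^ n + (1 - l) * (1 - l) ^ n) * y"
  and "2 * 2 ^ n * ((1 - (1 - l) / 2) * ((1 - l) / 2) ^ n * ((1 - l) * q)) =
     (1 - l\<^sup>2) * (1 - l) ^ n * q"
  by (simp_all add: power_divide power2_eq_square field_simps)

context
  fixes R :: "bool \<Rightarrow> nat" and l :: real and v :: "belief \<Rightarrow> real"
  assumes sol: "discounted_solution R l v" and l: "0 < l" "l < 1" and R: "R False \<ge> 1"
begin

lemma solution_Done: "v (Done b) = of_bool b"
proof -
  have "v (Done b) = l * of_bool b + (1 - l) * v (Done b)"
    using discounted_solutionD(1)[OF sol, of "Done b"] by simp
  then have "l * v (Done b) = l * of_bool b"
    by (simp add: algebra_simps)
  then show ?thesis
    using l by simp
qed

lemma solution_Run_False: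
  "v (Run False n) = max ((1 - l) / 2 * (v (Run False (Suc n)) + v (Run False 0)))
     ((1 - l) * (1 - risk R False n) * v (Run True 0))"
proof -
  have "v (Run False n) = (1 - l) * opt R v (Run False n)"
    using discounted_solutionD(1)[OF sol, of "Run False n"] by simp
  also have "\<dots> = max ((1 - l) * continuation R v (Run False n) C)
      ((1 - l) * continuation R v (Run False n) Q)"
    using l by (simp only: opt_cases max_mult_distrib_left) simp
  finally show ?thesis
    by (simp add: solution_Done add.commute mult.assoc)
qed

lemma wait_then_quit_ge:
  "(2 * l * 2 ^ n + (1 - l) * (1 - l) ^ n) * v (Run False 0) \<ge>
     (1 - l\<^sup>2) * (1 - l) ^ n * (1 - risk R False n) * v (Run True 0)"
proof -
  let ?t = "(1 - l) / 2" and ?x = "v (Run True 0)" and ?y = "v (Run False 0)"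
  let ?q = "(1 - l) * (1 - risk R False n) * ?x"
  have wait: "?t * (v (Run False (Suc j)) + ?y) \<le> v (Run False j)" for j
    unfolding solution_Run_False[of j] by (rule max.cobounded1)
  have quit: "?q \<le> v (Run False n)"
    unfolding solution_Run_False[of n] by (rule max.cobounded2)
  have "(1 - ?t) * ?t ^ n * ?q \<le> (1 - ?t) * ?t ^ n * v (Run False n)"
    using l quit by (intro mult_left_mono) auto
  also have "\<dots> \<le> (1 - 2 * ?t + ?t ^ Suc n) * ?y"
    using l wait by (intro wait_recursion(2)[where z = "\<lambda>j. v (Run False j)"]) auto
  finally have "2 * 2 ^ n * ((1 - ?t) * ?t ^ n * ?q) \<le> 2 * 2 ^ n * ((1 - 2 * ?t + ?t ^ Suc n) * ?y)"
    by (intro mult_left_mono) auto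
  then show ?thesis
    unfolding wait_clear_denominators mult.assoc[of "1 - l" "1 - risk R False n"]
    by (simp only: mult.assoc)
qed

text \<open>Player 1 does quit at some \<open>n\<close> in the optimum: a player who never quits gets \<open>0\<close>, whereas quitting
  after one period already gives a positive value.\<close>

lemma wait_then_quit_eq:
  "\<exists>n. (2 * l * 2 ^ n + (1 - l) * (1 - l) ^ n) * v (Run False 0) =
     (1 - l\<^sup>2) * (1 - l) ^ n * (1 - risk R False n) * v (Run True 0)"
proof -
  let ?t = "(1 - l) / 2" and ?x = "v (Run True 0)" and ?y = "v (Run False 0)"
  let ?q = "\<lambda>n. (1 - l) * (1 - risk R False n) * ?x"
  let ?z = "\<lambda>n. v (Run False n)"
  have wait: "?z j = ?t * (?z (Suc j) + ?y)" if "?z j \<noteq> ?q j" for j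
    using solution_Run_False[of j] that by (auto simp: max_def split: if_splits)
  have "\<exists>n. ?z n = ?q n"
  proof (rule ccontr)
    assume "\<nexists>n. ?z n = ?q n"
    then have "(1 - 2 * ?t + ?t ^ Suc n) * ?y = (1 - ?t) * ?t ^ n * ?z n" for n
      using wait by (intro wait_recursion(1)[where z = ?z]) blast+
    then have eq: "(l + ?t ^ Suc n) * ?y = (1 - ?t) * ?t ^ n * ?z n" for n
      by (simp add: diff_divide_distrib)
    have "l * ?y \<le> ?t ^ n" for n
    proof -
      have "l * ?y \<le> (l + ?t ^ Suc n) * ?y"
        using l discounted_solutionD(2)[OF sol] by (intro mult_right_mono) auto
      also have "\<dots> \<le> 1 * ?t ^ n * 1"
        unfolding eq using l discounted_solutionD(2,3)[OF sol] by (intro mult_mono) auto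
      finally show ?thesis by simp
    qed
    moreover have "(\<lambda>n. ?t ^ n) \<longlonglongrightarrow> 0"
      using l by (intro LIMSEQ_realpow_zero) auto
    ultimately have "l * ?y \<le> 0"
      by (meson LIMSEQ_le_const)
    then have y: "?y \<le> 0"
      using l by (simp add: mult_le_0_iff)
    have "?x \<ge> l"
    proof -
      have "0 \<le> opt R v (Run True 0)"
        using opt_mono[of "\<lambda>s. 0" v R "Run True 0"] discounted_solutionD(2)[OF sol] by simp
      then have "0 \<le> (1 - l) * opt R v (Run True 0)"
        using l by simp
      then show ?thesis
        using discounted_solutionD(1)[OF sol, of "Run True 0"] by (simp only: side.simps of_bool_eq)
    qed
    moreover have "risk R False (R False) < 1"
    proof -
      have "risk R False (R False) = (1 / 2) ^ R False"
        using R by (simp add: risk_def)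
      then show ?thesis
        using R power_Suc_less_one[of "1 / 2 :: real" "R False - 1"] by simp
    qed
    moreover have "l\<^sup>2 < 1"
      using l by (simp add: abs_square_less_1)
    ultimately have "0 < (1 - l\<^sup>2) * (1 - l) ^ R False * (1 - risk R False (R False)) * ?x"
      using l by (intro mult_pos_pos zero_less_power) linarith+
    also have "\<dots> \<le> (2 * l * 2 ^ R False + (1 - l) * (1 - l) ^ R False) * ?y"
      by (rule wait_then_quit_ge)
    also have "\<dots> \<le> 0"
      using l y by (intro mult_nonneg_nonpos) auto
    finally show False by simp
  qed
  define n where "n = (LEAST n. ?z n = ?q n)"
  have quit: "?z n = ?q n"
    using \<open>\<exists>n. ?z n = ?q n\<close> unfolding n_def by (rule LeastI_ex)
  have "?z j = ?t * (?z (Suc j) + ?y)" if "j < n" for j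
    using wait not_less_Least that unfolding n_def by blast
  then have "(1 - 2 * ?t + ?t ^ Suc n) * ?y = (1 - ?t) * ?t ^ n * ?z n"
    by (intro wait_recursion(1)[where z = ?z]) blast+
  then have "2 * 2 ^ n * ((1 - 2 * ?t + ?t ^ Suc n) * ?y) = 2 * 2 ^ n * ((1 - ?t) * ?t ^ n * ?q n)"
    unfolding quit by (rule arg_cong)
  then show ?thesis
    unfolding wait_clear_denominators mult.assoc[of "1 - l" "1 - risk R False n"]
    by (intro exI[of _ n]) (simp only: mult.assoc)
qed

text \<open>However Player 1 times the exit, the cost of waiting and the risk are both lost.\<close>

lemma solution_gap_ge:
  "\<exists>n. v (Run True 0) - v (Run False 0) \<ge> v (Run False 0) * (l * 2 ^ n + risk R False n)"
proof -
  let ?x = "v (Run True 0)" and ?y = "v (Run False 0)"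
  obtain n where n: "(2 * l * 2 ^ n + (1 - l) * (1 - l) ^ n) * ?y =
     (1 - l\<^sup>2) * (1 - l) ^ n * (1 - risk R False n) * ?x"
    using wait_then_quit_eq by blast
  let ?\<rho> = "risk R False n" and ?w = "(1 - l) ^ n"
  have x: "0 \<le> ?x" and y: "0 \<le> ?y"
    using discounted_solutionD(2)[OF sol] by auto
  have \<rho>: "0 < ?\<rho>" "?\<rho> \<le> 1"
    using risk_bounds by auto
  have w: "0 < ?w" "?w \<le> 1"
    using l by (auto intro: power_le_one)
  have "?w * ((1 + l * 2 ^ n) * ?y) \<le> (2 * l * 2 ^ n + (1 - l) * ?w) * ?y"
  proof -
    have "?w * l \<le> l * 2 ^ n"
    proof -
      have "?w \<le> 2 ^ n"
        using w one_le_power[of "2::real" n] by linarith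
      then show ?thesis
        using l by (simp add: mult.commute)
    qed
    moreover have "?w * (l * 2 ^ n) \<le> 1 * (l * 2 ^ n)"
      using l w by (intro mult_right_mono) auto
    ultimately have "?w * (1 + l * 2 ^ n) \<le> 2 * l * 2 ^ n + (1 - l) * ?w"
      by (simp add: algebra_simps)
    then show ?thesis
      using y by (metis mult.assoc mult_right_mono)
  qed
  also have "\<dots> \<le> ?w * ((1 - ?\<rho>) * ?x)"
  proof -
    have "(1 - l\<^sup>2) * (?w * ((1 - ?\<rho>) * ?x)) \<le> ?w * ((1 - ?\<rho>) * ?x)"
      using l w \<rho> x by (intro mult_left_le_one_le mult_nonneg_nonneg)
        (auto simp: power_le_one)
    then show ?thesis
      unfolding n by (simp add: mult.assoc)
  qed
  finally have *: "(1 + l * 2 ^ n) * ?y \<le> (1 - ?\<rho>) * ?x"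
    using w by simp
  have "?y \<le> (1 + l * 2 ^ n) * ?y"
    using l y by (simp add: algebra_simps)
  also note *
  also have "(1 - ?\<rho>) * ?x \<le> ?x"
    using \<rho> x by (intro mult_left_le_one_le) auto
  finally have "?\<rho> * ?y \<le> ?\<rho> * ?x"
    using \<rho> by (intro mult_left_mono) auto
  with * show ?thesis
    by (intro exI[of _ n]) (simp add: algebra_simps)
qed

text \<open>A particular waiting time bounds the loss from above.  The assumption says that discounting is
  moderate within \<open>n\<close> stages, so that a run of \<open>n\<close> signals \<open>D\<close> costs no more than \<open>4 * l * 2 ^ n\<close>;
  another \<open>l * 2 ^ n\<close> covers the term \<open>l\<^sup>2\<close>.\<close>

lemma solution_gap_le:
  assumes "(1 - l) ^ n \<ge> 1 / 2"
  shows "v (Run True 0) - v (Run False 0) \<le> v (Run True 0) * (risk R False n + 5 * l * 2 ^ n)"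
proof -
  let ?x = "v (Run True 0)" and ?y = "v (Run False 0)"
  let ?\<rho> = "risk R False n" and ?w = "(1 - l) ^ n"
  have x: "0 \<le> ?x" and y: "0 \<le> ?y"
    using discounted_solutionD(2)[OF sol] by auto
  have \<rho>: "0 < ?\<rho>" "?\<rho> \<le> 1"
    using risk_bounds by auto
  obtain k where k: "v (Run True 0) - v (Run False 0) \<ge> v (Run False 0) * (l * 2 ^ k + risk R False k)"
    using solution_gap_ge by blast
  have "0 \<le> ?y * (l * 2 ^ k + risk R False k)"
    using l y risk_bounds(1)[of R False k] by (intro mult_nonneg_nonneg) auto
  with k have yx: "?y \<le> ?x"
    by linarith
  have "?w * ((1 - l\<^sup>2) * (1 - ?\<rho>) * ?x) \<le> (2 * l * 2 ^ n + (1 - l) * ?w) * ?y"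
    using wait_then_quit_ge[of n] by (simp add: mult.assoc mult.left_commute)
  also have "\<dots> \<le> ?w * (4 * l * 2 ^ n * ?x + ?y)"
  proof -
    have "2 * l * 2 ^ n * ?y \<le> ?w * (4 * l * 2 ^ n * ?x)"
    proof -
      have "(1 / 2) * (4 * l * 2 ^ n * ?y) \<le> ?w * (4 * l * 2 ^ n * ?x)"
        using assms l y yx by (intro mult_mono) auto
      then show ?thesis by simp
    qed
    moreover have "(1 - l) * ?w * ?y \<le> ?w * ?y"
      using l y by (intro mult_right_mono mult_left_le_one_le) auto
    ultimately show ?thesis
      by (simp add: algebra_simps)
  qed
  finally have "(1 - l\<^sup>2) * (1 - ?\<rho>) * ?x \<le> 4 * l * 2 ^ n * ?x + ?y"
    using l by simp
  moreover have "(1 - l\<^sup>2 - ?\<rho>) * ?x \<le> (1 - l\<^sup>2) * (1 - ?\<rho>) * ?x"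
    using x \<rho> by (intro mult_right_mono) (auto simp: algebra_simps)
  moreover have "l\<^sup>2 * ?x \<le> l * 2 ^ n * ?x"
  proof (intro mult_right_mono x)
    have "l * l \<le> l * 2 ^ n"
      using l one_le_power[of "2::real" n] by (intro mult_left_mono) linarith+
    then show "l\<^sup>2 \<le> l * 2 ^ n"
      by (simp add: power2_eq_square)
  qed
  ultimately show ?thesis
    by (simp add: algebra_simps)
qed

end

lemma power_one_minus_ge_half:
  assumes "n \<ge> 1"
  shows "(1 - (1 / 2 ^ (2 * n)) :: real) ^ n \<ge> 1 / 2"
proof -
  have "real n \<le> 2 ^ n"
    using of_nat_less_two_power[of n] by (simp add: less_imp_le)
  then have "real n / 2 ^ (2 * n) \<le> 2 ^ n / 2 ^ (2 * n)"
    by (intro divide_right_mono) auto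
  also have "\<dots> = 1 / 2 ^ n"
    by (simp add: mult_2 power_add)
  also have "\<dots> \<le> 1 / 2"
    using assms self_le_power[of "2::real" n] by (intro divide_left_mono) auto
  finally have "real n / 2 ^ (2 * n) \<le> 1 / 2" .
  moreover have "1 - real n / 2 ^ (2 * n) \<le> (1 - 1 / 2 ^ (2 * n)) ^ n"
    using Bernoulli_inequality[of "- (1 / 2 ^ (2 * n)) :: real" n] by simp
  ultimately show ?thesis
    by linarith
qed

lemma discount_bounds:
  assumes "n \<ge> 1"
  shows "0 < (1 / 2 ^ (2 * n) :: real)" "(1 / 2 ^ (2 * n) :: real) < 1"
  using assms one_less_power[of "2::real" "2 * n"] by auto

text \<open>At a multiple \<open>n\<close> of the period the risk is exactly \<open>2 ^ (- n)\<close>, which is balanced with the cost of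
  waiting \<open>l * 2 ^ n\<close> when \<open>l = 2 ^ (- 2 n)\<close>.\<close>

lemma gap_le_at_multiple:
  assumes sol: "discounted_solution R (1 / 2 ^ (2 * n)) v"
    and R: "R False \<ge> 1" and n: "n \<ge> 1" "R False dvd n"
  shows "v (Run True 0) - v (Run False 0) \<le> 6 / 2 ^ n * v (Run True 0)"
proof -
  let ?l = "1 / 2 ^ (2 * n) :: real"
  have l: "0 < ?l" "?l < 1"
    by (rule discount_bounds[OF n(1)])+
  have "risk R False n = 1 / 2 ^ n"
    using n R by (simp add: risk_def power_divide)
  moreover have "5 * ?l * 2 ^ n = 5 / 2 ^ n"
    by (simp add: mult_2 power_add)
  ultimately show ?thesis
    using solution_gap_le[OF sol l R power_one_minus_ge_half[OF n(1)]] by (simp add: mult.commute)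
qed

text \<open>The risk after \<open>n\<close> signals is at least \<open>2 ^ (- n)\<close>, so the loss cannot be smaller than of order
  \<open>sqrt l\<close>, for any period.\<close>

lemma loss_ge:
  "l * 2 ^ n + risk R b n \<ge> 1 / 2 ^ m" if "l = 1 / 2 ^ (2 * m)"
proof (cases "m \<le> n")
  case True
  have "1 / 2 ^ m = l * 2 ^ m"
    by (simp add: that mult_2 power_add)
  also have "\<dots> \<le> l * 2 ^ n"
    using True by (intro mult_left_mono power_increasing) (auto simp: that)
  finally show ?thesis
    using risk_bounds(1)[of R b n] by linarith
next
  case False
  have "(1 / 2 :: real) ^ m \<le> risk R b n"
    unfolding risk_def using False
    by (intro power_decreasing) (auto intro: order_trans[OF times_div_less_eq_dividend])
  moreover have "0 \<le> l * 2 ^ n"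
    by (simp add: that)
  ultimately show ?thesis
    by (simp add: power_divide)
qed

text \<open>At this discount factor Player 2 loses at most \<open>6 * sqrt l\<close> relative to \<open>1 - y\<close>, and Player 1 at
  least \<open>sqrt l\<close> relative to \<open>y\<close>.  Both relative losses express the same gap, hence \<open>y \<le> 6 * (1 - y)\<close>.\<close>

lemma discounted_value_low:
  assumes sol: "discounted_solution (period r) (1 / 2 ^ (2 * (2 * r * m))) v"
    and r: "r \<ge> 1" and m: "m \<ge> 1"
  shows "v (Run False 0) \<le> 6 / 7"
proof -
  let ?n = "2 * r * m"
  let ?l = "1 / 2 ^ (2 * ?n) :: real"
  let ?x = "v (Run True 0)" and ?y = "v (Run False 0)"
  have n: "?n \<ge> 1"
    using r m by simp
  have l: "0 < ?l" "?l < 1"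
    by (rule discount_bounds[OF n])+
  obtain k where k: "?x - ?y \<ge> ?y * (?l * 2 ^ k + risk (period r) False k)"
    using solution_gap_ge[OF sol l] r by (auto simp: period_def)
  have "?y * (1 / 2 ^ ?n) \<le> ?y * (?l * 2 ^ k + risk (period r) False k)"
    by (intro mult_left_mono loss_ge refl discounted_solutionD(2)[OF sol])
  also note k
  also have "?x - ?y \<le> 6 / 2 ^ ?n * (1 - ?y)"
    using gap_le_at_multiple[OF discounted_solution_flip[OF sol]] r n by (simp add: period_def)
  finally have "?y \<le> 6 * (1 - ?y)"
    by (simp add: field_simps)
  then show ?thesis
    by simp
qed

text \<open>Now the waiting time that balances cost and risk is available to Player 1 but falls in the
  middle of a period of Player 2.  Before the period ends, the risk of Player 2 is at least
  \<open>2 ^ (- 2 r m) = 2 ^ r * sqrt l\<close>; afterwards the cost of waiting is as large.  So \<open>1 - x\<close> is at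
  most \<open>6 / 2 ^ r\<close>, and the gap \<open>x - y\<close> satisfies the same bound; \<open>r \<ge> 7\<close> makes the sum of the
  two less than \<open>1 / 10\<close>.\<close>

lemma discounted_value_high:
  assumes sol: "discounted_solution (period r) (1 / 2 ^ (2 * ((2 * m + 1) * r))) v"
    and r: "r \<ge> 7"
  shows "v (Run False 0) \<ge> 9 / 10"
proof -
  let ?n = "(2 * m + 1) * r" and ?R = "\<lambda>b. period r (\<not> b)"
  let ?l = "1 / 2 ^ (2 * ?n) :: real"
  let ?x = "v (Run True 0)" and ?y = "v (Run False 0)"
  have n: "?n \<ge> 1"
    using r by simp
  have l: "0 < ?l" "?l < 1"
    by (rule discount_bounds[OF n])+
  have x: "0 \<le> ?x" "?x \<le> 1"
    using discounted_solutionD(2,3)[OF sol] by auto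
  have gap: "?x - ?y \<le> 6 / 2 ^ ?n * ?x"
  proof (rule gap_le_at_multiple[OF sol _ n])
    show "1 \<le> period r False" "period r False dvd ?n"
      using r by (auto simp only: period_def dvd_triv_right if_False)
  qed
  obtain k where k: "?x - ?y \<ge> (1 - ?x) * (?l * 2 ^ k + risk ?R False k)"
    using solution_gap_ge[OF discounted_solution_flip[OF sol] l] r by (auto simp: period_def)
  have "1 / 2 ^ (2 * r * m) \<le> ?l * 2 ^ k + risk ?R False k"
  proof (cases "k < 2 * r * (m + 1)")
    case True
    then have "k < (m + 1) * (2 * r)"
      by (simp add: mult.commute)
    then have "k div (2 * r) < m + 1"
      using r by (simp only: div_less_iff_less_mult)
    then have "k div (2 * r) \<le> m"
      by simp
    then have "(1 / 2 :: real) ^ (2 * r * m) \<le> risk ?R False k"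
      unfolding risk_def by (intro power_decreasing) (auto simp: period_def)
    moreover have "0 \<le> ?l * 2 ^ k"
      by simp
    ultimately show ?thesis
      unfolding power_one_over by linarith
  next
    case False
    have "?l * 2 ^ (2 * r * (m + 1)) \<le> ?l * 2 ^ k"
      using False by (intro mult_left_mono power_increasing) auto
    moreover have "2 * ?n = 2 * r * (m + 1) + 2 * r * m"
      by (simp add: algebra_simps)
    then have "?l * 2 ^ (2 * r * (m + 1)) = 1 / 2 ^ (2 * r * m)"
      by (simp only: power_add times_divide_eq_left mult_1_left)
         (rule nonzero_divide_mult_cancel_left, simp)
    ultimately show ?thesis
      using risk_bounds(1)[of ?R False k] by linarith
  qed
  then have "(1 - ?x) * (1 / 2 ^ (2 * r * m)) \<le> (1 - ?x) * (?l * 2 ^ k + risk ?R False k)"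
    using x by (intro mult_left_mono) auto
  also have "\<dots> \<le> 6 / 2 ^ ?n * ?x"
    using k gap by linarith
  also have "\<dots> \<le> 6 / 2 ^ ?n * 1"
    using x by (intro mult_left_mono) auto
  also have "\<dots> = 6 / 2 ^ r * (1 / 2 ^ (2 * r * m))"
    by (simp add: algebra_simps power_add)
  finally have "1 - ?x \<le> 6 / 2 ^ r"
    by (rule mult_right_le_imp_le) simp
  moreover have "6 / 2 ^ ?n * ?x \<le> 6 / 2 ^ r * 1"
  proof (intro mult_mono)
    show "6 / 2 ^ ?n \<le> (6 / 2 ^ r :: real)"
      by (intro divide_left_mono power_increasing) auto
  qed (use x in auto)
  moreover have "6 / 2 ^ r \<le> (6 / 2 ^ 7 :: real)"
    using r by (intro divide_left_mono power_increasing) auto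
  ultimately show ?thesis
    using gap by simp
qed

section \<open>From n-stage to discounted values\<close>

lemma funpow_stage_op_Suc:
  "(stage_op R ^^ Suc n) f s = reward s + opt R ((stage_op R ^^ n) f) s"
  by (simp add: stage_op_def)

lemma funpow_stage_op_nonexpansive:
  assumes "\<And>s. \<bar>f s - g s\<bar> \<le> c"
  shows "\<bar>(stage_op R ^^ n) f s - (stage_op R ^^ n) g s\<bar> \<le> c"
proof (induction n arbitrary: s)
  case (Suc n)
  then show ?case
    using opt_nonexpansive[of "(stage_op R ^^ n) f" "(stage_op R ^^ n) g" c R s]
    unfolding funpow_stage_op_Suc by simp
qed (use assms in simp)

text \<open>Only the \<open>n\<close> stage rewards are scaled differently on the two sides, since \<open>opt\<close> is positively
  homogeneous.\<close>

lemma funpow_stage_op_scale: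
  assumes l: "0 \<le> l" "l \<le> 1"
  shows "\<bar>(1 - l) * (stage_op R ^^ n) f s - (stage_op R ^^ n) (\<lambda>s. (1 - l) * f s) s\<bar> \<le> l * n"
proof (induction n arbitrary: s)
  case (Suc n)
  let ?F = "(stage_op R ^^ n) f" and ?G = "(stage_op R ^^ n) (\<lambda>s. (1 - l) * f s)"
  have "\<bar>opt R (\<lambda>s. (1 - l) * ?F s) s - opt R ?G s\<bar> \<le> l * n"
    using Suc by (rule opt_nonexpansive)
  moreover have "(1 - l) * opt R ?F s = opt R (\<lambda>s. (1 - l) * ?F s) s"
    using l by (simp add: opt_scale)
  moreover have "\<bar>(1 - l) * reward s - reward s\<bar> \<le> l"
    using l by auto
  moreover have "l * real (Suc n) = l * n + l"
    by (simp add: algebra_simps)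
  ultimately show ?case
    unfolding funpow_stage_op_Suc distrib_left by linarith
qed simp

text \<open>During \<open>n\<close> stages the discount changes each of the \<open>n\<close> weights by at most \<open>l * n\<close>.  Thus the
  unnormalised discounted value \<open>v / l\<close> nearly satisfies the equation of an undiscounted game that
  lasts \<open>n\<close> stages and then pays \<open>(1 - l) ^ n * v / l\<close>.\<close>

lemma discounted_solution_block:
  assumes sol: "discounted_solution R l v" and l: "0 < l" "l < 1"
  shows "\<bar>v s / l - (stage_op R ^^ n) (\<lambda>s. (1 - l) ^ n * (v s / l)) s\<bar> \<le> l * real n ^ 2"
proof (induction n arbitrary: s)
  case (Suc n)
  let ?w = "\<lambda>s. v s / l"
  let ?G = "(stage_op R ^^ n) (\<lambda>s. (1 - l) ^ n * ?w s)"
  have w: "?w s = stage_op R (\<lambda>s. (1 - l) * ?w s) s"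
  proof -
    have "v s = l * reward s + (1 - l) * opt R v s"
      by (rule discounted_solutionD(1)[OF sol])
    then have "?w s = reward s + (1 - l) / l * opt R v s"
      using l by (simp add: add_divide_distrib)
    moreover have "opt R (\<lambda>s. (1 - l) / l * v s) s = (1 - l) / l * opt R v s"
      using l by (intro opt_scale) auto
    ultimately show ?thesis
      by (simp add: stage_op_def)
  qed
  have "\<bar>(1 - l) * ?w s - (stage_op R ^^ n) (\<lambda>s. (1 - l) ^ Suc n * ?w s) s\<bar> \<le> l * real (Suc n) ^ 2"
    for s
  proof -
    have "\<bar>(1 - l) * ?w s - (1 - l) * ?G s\<bar> = (1 - l) * \<bar>?w s - ?G s\<bar>"
      using l unfolding right_diff_distrib[symmetric] abs_mult by simp
    also have "\<dots> \<le> 1 * (l * real n ^ 2)"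
      using l Suc[of s] by (intro mult_mono) auto
    finally have 1: "\<bar>(1 - l) * ?w s - (1 - l) * ?G s\<bar> \<le> l * real n ^ 2"
      by simp
    have 2: "\<bar>(1 - l) * ?G s - (stage_op R ^^ n) (\<lambda>s. (1 - l) ^ Suc n * ?w s) s\<bar> \<le> l * n"
      using funpow_stage_op_scale[where l = l and R = R and n = n and f = "\<lambda>s. (1 - l) ^ n * ?w s" and s = s] l
      by (simp add: mult.assoc)
    have "l * real n ^ 2 + l * n \<le> l * real (Suc n) ^ 2"
      using l by (simp add: power2_eq_square algebra_simps)
    with 1 2 show ?thesis
      by linarith
  qed
  then have "\<bar>opt R (\<lambda>s. (1 - l) * ?w s) s - opt R ((stage_op R ^^ n) (\<lambda>s. (1 - l) ^ Suc n * ?w s)) s\<bar>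
      \<le> l * real (Suc n) ^ 2"
    by (rule opt_nonexpansive)
  moreover have "?w s = reward s + opt R (\<lambda>s. (1 - l) * ?w s) s"
    using w by (simp add: stage_op_def)
  ultimately show ?case
    unfolding funpow_stage_op_Suc by linarith
qed simp

lemma total_value_add: "total_value R (m + n) = (stage_op R ^^ n) (total_value R m)"
  by (induction n) auto

lemma power_one_minus_le:
  fixes l :: real
  assumes "0 \<le> l" "l \<le> 1"
  shows "(1 - l) ^ n \<le> 1 - n * l + (n * l)\<^sup>2"
proof -
  have "(1 + n * l) * (1 - l) ^ n \<le> (1 + l) ^ n * (1 - l) ^ n"
    using assms Bernoulli_inequality[of l n] by (intro mult_right_mono) auto
  also have "\<dots> = (1 - l\<^sup>2) ^ n"
    by (simp add: power_mult_distrib[symmetric] algebra_simps power2_eq_square)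
  also have "\<dots> \<le> 1"
    using assms by (intro power_le_one) (auto simp: power_le_one)
  also have "1 \<le> (1 + n * l) * (1 - n * l + (n * l)\<^sup>2)"
    using assms by (simp add: algebra_simps power2_eq_square)
  finally have "(1 + n * l) * (1 - l) ^ n \<le> (1 + n * l) * (1 - n * l + (n * l)\<^sup>2)" .
  moreover have "0 < 1 + n * l"
    using assms by (intro add_pos_nonneg) auto
  ultimately show ?thesis
    by (simp only: mult_le_cancel_left_pos)
qed

text \<open>Let \<open>L = M * n = 1 / l\<close>.  Both \<open>v / l\<close> and the value of the \<open>L\<close>-stage game come from \<open>n\<close> stages
  of the same nonexpansive operator, applied to \<open>(1 - l) ^ n * v / l\<close> and to the value of the
  \<open>L - n\<close> stage game, which is close to \<open>(L - n) * c\<close>.  As \<open>(1 - l) ^ n\<close> is \<open>1 - 1 / M\<close> up to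
  \<open>1 / M\<^sup>2\<close>, the distance between \<open>v\<close> and \<open>c\<close> contracts by the factor \<open>1 - 1 / (2 * M)\<close> up to errors
  of order \<open>1 / M\<^sup>2\<close> and \<open>d\<close>, hence it is of order \<open>1 / M + M * d\<close>.\<close>

lemma tauberian_block:
  assumes sol: "discounted_solution R l v" and l: "l = 1 / real (M * n)"
    and M: "M \<ge> 2" "n \<ge> 1"
    and c: "\<And>s. 0 \<le> c s" "\<And>s. c s \<le> 1"
    and close: "\<And>k s. n \<le> k \<Longrightarrow> \<bar>total_value R k s - k * c s\<bar> \<le> k * d"
  shows "\<bar>v s - c s\<bar> \<le> 4 / M + 4 * M * d"
proof -
  define L where "L = real (M * n)"
  have L: "L > 1" "l = 1 / L" "L = real M * real n"
    using M less_1_mult[of "real M" "real n"] by (auto simp: L_def l intro: less_le_trans[of 1 "real M"])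
  then have l01: "0 < l" "l < 1"
    by auto
  define q where "q = (1 - l) ^ n"
  have nl: "real n * l = 1 / M"
    using M L by (simp add: l)
  have q0: "0 \<le> q"
    using l01 by (simp add: q_def)
  have q_le: "q \<le> 1 - 1 / M + (1 / M)\<^sup>2"
    using power_one_minus_le[of l n] l01 by (simp add: q_def nl)
  have q_ge: "1 - 1 / M \<le> q"
    using Bernoulli_inequality[of "- l" n] l01 by (simp add: q_def nl)
  have v01: "0 \<le> v s" "v s \<le> 1" for s
    using discounted_solutionD[OF sol] by blast+
  define e where "e = (SUP s. \<bar>v s - c s\<bar>)"
  have "\<bar>v s - c s\<bar> \<le> 1" for s
    using v01[of s] c[of s] by linarith
  then have bdd: "bdd_above (range (\<lambda>s. \<bar>v s - c s\<bar>))"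
    by (rule bdd_aboveI2)
  have e: "\<bar>v s - c s\<bar> \<le> e" for s
    unfolding e_def by (rule cSUP_upper[OF _ bdd]) simp
  have d0: "0 \<le> d"
  proof -
    have "0 \<le> real n * d"
      using close[of n s] by linarith
    then show ?thesis
      using M by (simp add: zero_le_mult_iff)
  qed
  have bound: "\<bar>v s - c s\<bar> \<le> 2 / M ^ 2 + 2 * d + q * e" for s
  proof -
    have near: "\<bar>q * (v s / l) - total_value R (M * n - n) s\<bar> \<le> q * (L * e) + n / M + L * d" for s
    proof -
      have k: "real (M * n - n) = L - n" "n \<le> M * n - n"
        using M by (auto simp: L_def of_nat_diff le_diff_conv2 mult_2[symmetric])
      have "\<bar>total_value R (M * n - n) s - (L - n) * c s\<bar> \<le> (L - n) * d"
        using close[OF k(2), of s] by (simp add: k)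
      also have "\<dots> \<le> L * d"
        using d0 by (intro mult_right_mono) auto
      finally have 1: "\<bar>total_value R (M * n - n) s - (L - n) * c s\<bar> \<le> L * d" .
      have "q * (v s / l) - q * (L * c s) = q * L * (v s - c s)"
        unfolding L(2) by (simp add: algebra_simps)
      then have "\<bar>q * (v s / l) - q * (L * c s)\<bar> = q * L * \<bar>v s - c s\<bar>"
        using q0 L(1) by (simp add: abs_mult)
      also have "\<dots> \<le> q * L * e"
        using q0 L e[of s] by (intro mult_left_mono) auto
      finally have 2: "\<bar>q * (v s / l) - q * (L * c s)\<bar> \<le> q * (L * e)"
        by simp
      have "L * (1 - 1 / M) = L - n"
        using M by (simp add: L algebra_simps)
      moreover have "L * (1 - 1 / M + (1 / M)\<^sup>2) = L - n + n / M"
        using M by (simp add: L algebra_simps power2_eq_square)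
      moreover have "L * (1 - 1 / M) \<le> L * q" "L * q \<le> L * (1 - 1 / M + (1 / M)\<^sup>2)"
        using q_ge q_le L by (auto intro!: mult_left_mono)
      ultimately have "0 \<le> L * q - (L - n)" "L * q - (L - n) \<le> n / M"
        by linarith+
      then have "0 \<le> (L * q - (L - n)) * c s \<and> (L * q - (L - n)) * c s \<le> n / M * 1"
        using c[of s] by (intro conjI mult_mono mult_nonneg_nonneg) auto
      then have 3: "\<bar>q * (L * c s) - (L - n) * c s\<bar> \<le> n / M"
        by (simp add: algebra_simps)
      from 1 2 3 show ?thesis
        by linarith
    qed
    have "(stage_op R ^^ n) (total_value R (M * n - n)) = total_value R (M * n)"
      using M total_value_add[of R "M * n - n" n] by simp
    moreover have "\<bar>(stage_op R ^^ n) (\<lambda>s. q * (v s / l)) s -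
        (stage_op R ^^ n) (total_value R (M * n - n)) s\<bar> \<le> q * (L * e) + n / M + L * d"
      using near by (rule funpow_stage_op_nonexpansive)
    ultimately have "\<bar>(stage_op R ^^ n) (\<lambda>s. q * (v s / l)) s - total_value R (M * n) s\<bar>
        \<le> q * (L * e) + n / M + L * d"
      by (simp only:)
    moreover have "\<bar>v s / l - (stage_op R ^^ n) (\<lambda>s. q * (v s / l)) s\<bar> \<le> l * real n ^ 2"
      unfolding q_def by (rule discounted_solution_block[OF sol l01])
    moreover have "l * real n ^ 2 = n / M"
    proof -
      have "l * real n ^ 2 = real n * (real n * l)"
        by (simp add: power2_eq_square)
      then show ?thesis
        by (simp add: nl)
    qed
    moreover have "\<bar>total_value R (M * n) s - L * c s\<bar> \<le> L * d"
      using close[of "M * n" s] M by (simp add: L_def)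
    ultimately have "\<bar>v s / l - L * c s\<bar> \<le> q * (L * e) + n / M + L * d + n / M + L * d"
      by linarith
    moreover have "v s / l - L * c s = L * (v s - c s)"
      by (simp add: L algebra_simps)
    moreover have "q * (L * e) + n / M + L * d + n / M + L * d = L * (2 / M ^ 2 + 2 * d + q * e)"
      using M by (simp add: L field_simps power2_eq_square)
    ultimately have "L * \<bar>v s - c s\<bar> \<le> L * (2 / M ^ 2 + 2 * d + q * e)"
      using L by (simp add: abs_mult)
    then show ?thesis
      using L(1) by simp
  qed
  have "e \<le> 2 / M ^ 2 + 2 * d + q * e"
    unfolding e_def by (rule cSUP_least) (use bound in \<open>auto simp: e_def\<close>)
  moreover have "q * e \<le> (1 - 1 / (2 * M)) * e"
  proof (rule mult_right_mono)
    have "(1 / M)\<^sup>2 \<le> 1 / (2 * M)"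
      using M by (simp add: field_simps power2_eq_square)
    then show "q \<le> 1 - 1 / (2 * M)"
      using q_le by (simp add: field_simps)
    show "0 \<le> e"
      using e[of s] by linarith
  qed
  ultimately have "e / (2 * M) \<le> 2 / M ^ 2 + 2 * d"
    by (simp add: algebra_simps)
  then have "e \<le> (2 / M ^ 2 + 2 * d) * (2 * M)"
    using M by (simp add: pos_divide_le_eq)
  also have "\<dots> = 4 / M + 4 * M * d"
    using M by (simp add: field_simps power2_eq_square)
  finally show ?thesis
    using e[of s] by linarith
qed

text \<open>By \<open>total_gap\<close> the difference of the limits is at most the risk after any number \<open>k\<close> of signals,
  because the waiting time disappears after division by \<open>n\<close>.\<close>

lemma total_value_limits_agree:
  assumes R: "R False \<ge> 1"
    and x: "(\<lambda>n. total_value R n (Run True 0) / n) \<longlonglongrightarrow> x"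
    and y: "(\<lambda>n. total_value R n (Run False 0) / n) \<longlonglongrightarrow> y"
  shows "x = y"
proof (rule antisym)
  show "y \<le> x"
  proof (rule LIMSEQ_le[OF y x], intro exI allI impI)
    show "total_value R n (Run False 0) / n \<le> total_value R n (Run True 0) / n" for n
      using total_sandwich(1)[of R n True 0] by (intro divide_right_mono) auto
  qed
  have gap: "x - y \<le> risk R False k" for k
  proof (rule LIMSEQ_le)
    show "(\<lambda>n. total_value R n (Run True 0) / n - total_value R n (Run False 0) / n) \<longlonglongrightarrow> x - y"
      by (intro tendsto_intros x y)
    show "(\<lambda>n. risk R False k + 2 ^ (k + 1) / real n) \<longlonglongrightarrow> risk R False k"
      using tendsto_add[OF tendsto_const lim_const_over_n[of "2 ^ (k + 1)"], of "risk R False k"] by simp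
    show "\<exists>N. \<forall>n\<ge>N. total_value R n (Run True 0) / n - total_value R n (Run False 0) / n
        \<le> risk R False k + 2 ^ (k + 1) / real n"
    proof (intro exI[of _ 1] allI impI)
      fix n :: nat assume "1 \<le> n"
      then have "(total_value R n (Run True 0) - total_value R n (Run False 0)) / n
          \<le> (risk R False k * n + 2 ^ (k + 1)) / n"
        using total_gap[of R n k] by (intro divide_right_mono) auto
      then show "total_value R n (Run True 0) / n - total_value R n (Run False 0) / n
          \<le> risk R False k + 2 ^ (k + 1) / real n"
        using \<open>1 \<le> n\<close> by (simp add: diff_divide_distrib add_divide_distrib)
    qed
  qed
  have "x - y \<le> (1 / 2) ^ k" for k
  proof -
    have "risk R False (R False * k) = (1 / 2) ^ (R False * k)"
      using R by (simp add: risk_def)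
    also have "\<dots> \<le> (1 / 2) ^ k"
      using R by (intro power_decreasing) auto
    finally show ?thesis
      using gap[of "R False * k"] by linarith
  qed
  moreover have "(\<lambda>k. (1 / 2 :: real) ^ k) \<longlonglongrightarrow> 0"
    by (intro LIMSEQ_realpow_zero) auto
  ultimately show "x \<le> y"
    using LIMSEQ_le_const[of "\<lambda>k. (1 / 2 :: real) ^ k" 0 "x - y"] by auto
qed

text \<open>Since all beliefs \<open>Run b k\<close> are squeezed between the first states of the two sides, convergence at
  these two beliefs is uniform.  The block argument then applies with a fixed large \<open>M\<close>, while \<open>d\<close>
  may be taken small compared to \<open>1 / M\<close>.\<close>

lemma tauberian:
  assumes x: "(\<lambda>n. total_value R n (Run True 0) / n) \<longlonglongrightarrow> x"
    and y: "(\<lambda>n. total_value R n (Run False 0) / n) \<longlonglongrightarrow> x"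
    and e: "0 < e"
  shows "\<exists>K. \<forall>k\<ge>K. \<forall>v. discounted_solution R (1 / 2 ^ k) v \<longrightarrow> \<bar>v (Run False 0) - x\<bar> \<le> e"
proof -
  obtain q :: nat where q: "8 / e < 2 ^ q" "q \<ge> 1"
  proof -
    obtain q0 where "8 / e < 2 ^ q0"
      using real_arch_pow[of 2 "8 / e"] by auto
    also have "(2::real) ^ q0 \<le> 2 ^ Suc q0"
      by simp
    finally show thesis
      using that[of "Suc q0"] by simp
  qed
  \<comment> \<open>A power of \<open>2\<close>, so that \<open>2 ^ k\<close> stages split into \<open>M\<close> equal blocks.\<close>
  define M :: nat where "M = 2 ^ q"
  have M: "M \<ge> 2" "8 / e < M"
    using q self_le_power[of "2::nat" q] by (auto simp: M_def)
  define d where "d = e / (8 * M)"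
  have d: "0 < d"
    using e M by (simp add: d_def)
  define c where "c s = (case s of Run b k \<Rightarrow> x | Done b \<Rightarrow> of_bool b)" for s :: belief
  have lim01: "0 \<le> x" "x \<le> 1"
  proof -
    have "0 \<le> total_value R n (Run True 0) / n \<and> total_value R n (Run True 0) / n \<le> 1" for n
      using total_bounds[of R n] by (auto simp: divide_le_eq_1)
    then show "0 \<le> x" "x \<le> 1"
      using x by (meson LIMSEQ_le_const LIMSEQ_le_const2)+
  qed
  have close1: "eventually (\<lambda>n. \<bar>total_value R n (Run b 0) - n * x\<bar> \<le> n * d) sequentially" for b
  proof -
    have "(\<lambda>n. total_value R n (Run b 0) / n) \<longlonglongrightarrow> x"
      using x y by (cases b) auto
    then have "eventually (\<lambda>n. \<bar>total_value R n (Run b 0) / n - x\<bar> < d) sequentially"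
      using d by (auto simp: tendsto_iff dist_real_def)
    then show ?thesis
      using eventually_gt_at_top[of 0]
    proof eventually_elim
      case (elim n)
      have "\<bar>total_value R n (Run b 0) - n * x\<bar> = n * \<bar>total_value R n (Run b 0) / n - x\<bar>"
        using elim(2) abs_mult[of "real n" "total_value R n (Run b 0) / n - x"]
        by (simp add: right_diff_distrib)
      also have "\<dots> \<le> n * d"
        using elim by (intro mult_left_mono) auto
      finally show ?case .
    qed
  qed
  obtain N where N: "\<And>n b. n \<ge> N \<Longrightarrow> \<bar>total_value R n (Run b 0) - n * x\<bar> \<le> n * d"
    using eventually_conj[OF close1[of True] close1[of False]]
    unfolding eventually_sequentially by (metis (full_types))
  have close: "\<bar>total_value R n s - n * c s\<bar> \<le> n * d" if "n \<ge> N" for n s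
  proof (cases s)
    case (Run b k)
    then show ?thesis
      using N[OF that, of True] N[OF that, of False] total_sandwich[of R n b k]
      by (simp add: c_def)
  next
    case (Done b)
    then show ?thesis
      using d by (simp add: c_def total_Done)
  qed
  show ?thesis
  proof (intro exI[of _ "q + N"] allI impI)
    fix k v assume k: "q + N \<le> k" and sol: "discounted_solution R (1 / 2 ^ k) v"
    define n :: nat where "n = 2 ^ (k - q)"
    have "N \<le> k - q"
      using k by simp
    also have "k - q \<le> n"
      unfolding n_def using less_exp[of "k - q"] by simp
    finally have n: "N \<le> n" .
    have "M * n = 2 ^ k"
      using k by (simp add: M_def n_def power_add[symmetric])
    then have l: "1 / 2 ^ k = 1 / real (M * n)"
      by simp
    have "\<bar>v (Run False 0) - c (Run False 0)\<bar> \<le> 4 / M + 4 * M * d"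
      using n M close lim01
      by (intro tauberian_block[OF sol l]) (auto simp: c_def n_def split: belief.splits)
    also have "4 / M \<le> e / 2"
      using M e by (simp add: field_simps)
    also have "4 * M * d = e / 2"
      using M by (simp add: d_def)
    finally show "\<bar>v (Run False 0) - x\<bar> \<le> e"
      by (simp add: c_def)
  qed
qed

section \<open>Divergence\<close>

lemma belief_law_Run_0_in_prob_on:
  assumes "r \<ge> 1"
  shows "belief_law (period r) (Run b 0) \<in> prob_on (Gamma_states r)"
  using assms by (auto simp: belief_law_0 prob_on_def Gamma_states_def counter_state_def
      simp del: belief_law.simps(1))

lemma value_n_diverges:
  assumes r: "r \<ge> 7"
  shows "\<not> (\<exists>v. \<forall>p\<in>prob_on (Gamma_states r). (\<lambda>n. value_n (Gamma_game r) n p) \<longlonglongrightarrow> v p)"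
proof (rule notI, elim exE)
  fix v assume v: "\<forall>p\<in>prob_on (Gamma_states r). (\<lambda>n. value_n (Gamma_game r) n p) \<longlonglongrightarrow> v p"
  let ?R = "period r"
  have r1: "r \<ge> 1" and R: "?R False \<ge> 1"
    using r by (auto simp: period_def)
  define x where "x b = v (belief_law ?R (Run b 0))" for b
  have lim: "(\<lambda>n. total_value ?R n (Run b 0) / n) \<longlonglongrightarrow> x b" for b
  proof (rule Lim_transform_eventually)
    show "(\<lambda>n. value_n (Gamma_game r) n (belief_law ?R (Run b 0))) \<longlonglongrightarrow> x b"
      unfolding x_def by (intro v[rule_format] belief_law_Run_0_in_prob_on r1)
    show "\<forall>\<^sub>F n in sequentially. value_n (Gamma_game r) n (belief_law ?R (Run b 0)) =
        total_value ?R n (Run b 0) / n"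
      using eventually_ge_at_top[of 1] by eventually_elim (rule value_n_Gamma[OF r1])
  qed
  have "x True = x False"
    by (rule total_value_limits_agree[OF R lim lim])
  \<comment> \<open>The tolerance is chosen so that \<open>6 / 7 + 2 / 100 < 9 / 10\<close>.\<close>
  then obtain K where K: "\<And>k w. K \<le> k \<Longrightarrow> discounted_solution ?R (1 / 2 ^ k) w \<Longrightarrow>
      \<bar>w (Run False 0) - x False\<bar> \<le> 1 / 100"
    using tauberian[of ?R "x False" "1 / 100"] lim[of True] lim[of False] by auto
  define m where "m = Suc K"
  have large: "1 \<le> 2 * r * m" "K \<le> 2 * (2 * r * m)" "1 \<le> (2 * m + 1) * r" "K \<le> 2 * ((2 * m + 1) * r)"
  proof -
    have "m \<le> r * m" "m \<le> m * r"
      using r1 by simp_all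
    then show "1 \<le> 2 * r * m" "K \<le> 2 * (2 * r * m)" "1 \<le> (2 * m + 1) * r" "K \<le> 2 * ((2 * m + 1) * r)"
      using r1 by (auto simp: m_def)
  qed
  obtain w where w: "discounted_solution ?R (1 / 2 ^ (2 * (2 * r * m))) w"
    using discounted_solution_exists discount_bounds[OF large(1)] by blast
  obtain w' where w': "discounted_solution ?R (1 / 2 ^ (2 * ((2 * m + 1) * r))) w'"
    using discounted_solution_exists discount_bounds[OF large(3)] by blast
  have "w (Run False 0) \<le> 6 / 7"
    using discounted_value_low[OF w r1] by (simp add: m_def)
  moreover have "9 / 10 \<le> w' (Run False 0)"
    by (rule discounted_value_high[OF w' r])
  ultimately show False
    using K[OF large(2) w] K[OF large(4) w'] unfolding abs_le_iff by linarith
qed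

lemma value_disc_diverges:
  assumes r: "r \<ge> 7"
  shows "\<not> (\<exists>v. \<forall>p\<in>prob_on (Gamma_states r).
    ((\<lambda>l. value_disc (Gamma_game r) l p) \<longlongrightarrow> v p) (at_right 0))"
proof (rule notI, elim exE)
  fix v assume v: "\<forall>p\<in>prob_on (Gamma_states r).
    ((\<lambda>l. value_disc (Gamma_game r) l p) \<longlongrightarrow> v p) (at_right 0)"
  let ?R = "period r" and ?p = "belief_law (period r) (Run False 0)"
  have r1: "r \<ge> 1"
    using r by simp
  have lim: "(\<lambda>m. value_disc (Gamma_game r) (1 / 2 ^ (2 * f m)) ?p) \<longlonglongrightarrow> v ?p"
    if f: "\<And>m. m \<le> f m" for f :: "nat \<Rightarrow> nat"
  proof (rule filterlim_compose[OF v[rule_format, OF belief_law_Run_0_in_prob_on[OF r1]]])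
    have "(\<lambda>m. 1 / 2 ^ (2 * f m) :: real) \<longlonglongrightarrow> 0"
    proof (rule tendsto_sandwich)
      show "\<forall>\<^sub>F m in sequentially. (0::real) \<le> 1 / 2 ^ (2 * f m)"
        by simp
      show "\<forall>\<^sub>F m in sequentially. (1 / 2 ^ (2 * f m) :: real) \<le> (1 / 2) ^ m"
      proof (intro always_eventually allI)
        show "(1 / 2 ^ (2 * f m) :: real) \<le> (1 / 2) ^ m" for m
          unfolding power_one_over using f[of m] by (intro divide_left_mono power_increasing) auto
      qed
    qed (auto intro: LIMSEQ_realpow_zero)
    then show "filterlim (\<lambda>m. 1 / 2 ^ (2 * f m) :: real) (at_right 0) sequentially"
      by (auto simp: filterlim_at)
  qed
  have value_at: "\<exists>w. discounted_solution ?R (1 / 2 ^ (2 * n)) w \<and>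
      value_disc (Gamma_game r) (1 / 2 ^ (2 * n)) ?p = w (Run False 0)" if "n \<ge> 1" for n
    using discounted_solution_exists discount_bounds[OF that] value_disc_Gamma[OF r1] by metis
  have r_ge: "m \<le> r * m" "m \<le> m * r" for m
    using r1 by simp_all
  have "v ?p \<le> 6 / 7"
  proof (rule LIMSEQ_le_const2[OF lim])
    show "m \<le> 2 * r * m" for m
      using r_ge(1)[of m] by simp
    show "\<exists>N. \<forall>m\<ge>N. value_disc (Gamma_game r) (1 / 2 ^ (2 * (2 * r * m))) ?p \<le> 6 / 7"
    proof (intro exI[of _ 1] allI impI)
      fix m :: nat assume m: "1 \<le> m"
      then have "1 \<le> 2 * r * m"
        using r1 by simp
      then obtain w where "discounted_solution ?R (1 / 2 ^ (2 * (2 * r * m))) w"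
        "value_disc (Gamma_game r) (1 / 2 ^ (2 * (2 * r * m))) ?p = w (Run False 0)"
        using value_at by blast
      then show "value_disc (Gamma_game r) (1 / 2 ^ (2 * (2 * r * m))) ?p \<le> 6 / 7"
        using discounted_value_low[OF _ r1 m] by metis
    qed
  qed
  moreover have "9 / 10 \<le> v ?p"
  proof (rule LIMSEQ_le_const[OF lim])
    show "m \<le> (2 * m + 1) * r" for m
      using r_ge(2)[of m] by (simp only: distrib_right mult_2)
    show "\<exists>N. \<forall>m\<ge>N. 9 / 10 \<le> value_disc (Gamma_game r) (1 / 2 ^ (2 * ((2 * m + 1) * r))) ?p"
    proof (intro exI[of _ 0] allI impI)
      fix m :: nat
      have "1 \<le> (2 * m + 1) * r"
        using r1 by simp
      then obtain w where "discounted_solution ?R (1 / 2 ^ (2 * ((2 * m + 1) * r))) w"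
        "value_disc (Gamma_game r) (1 / 2 ^ (2 * ((2 * m + 1) * r))) ?p = w (Run False 0)"
        using value_at by blast
      then show "9 / 10 \<le> value_disc (Gamma_game r) (1 / 2 ^ (2 * ((2 * m + 1) * r))) ?p"
        using discounted_value_high[OF _ r] by metis
    qed
  qed
  ultimately show False
    by simp
qed

theorem theorem3p6:
  shows "\<exists>r0::nat. r0 \<ge> 1 \<and> (\<forall>r\<ge>r0.
     \<not> (\<exists>v. \<forall>p\<in>prob_on (Gamma_states r).
            (\<lambda>n. value_n (Gamma_game r) n p) \<longlonglongrightarrow> v p) \<and>
     \<not> (\<exists>v. \<forall>p\<in>prob_on (Gamma_states r).
            ((\<lambda>l. value_disc (Gamma_game r) l p) \<longlongrightarrow> v p) (at_right 0)))"
  using value_n_diverges value_disc_diverges by (intro exI[of _ 7]) simp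

end
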